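(* For all integers $p,q\ge 1$ and all radial functions $f,g$ such that $\mu_{p+1;f}<\infty$ and $\mu_{q+1;g}<\infty$ (with $f$ serving as radial function in dimension $p$ and $g$ in dimension $q$), $$\mathrm{ARE}^{p,f}_{q,g}(\phi_{vdW}/\phi_{\mathcal N})\ \ge\ 1,$$ where equality holds if and only if $f$ and $g$ are Gaussian with common scale, i.e. if and only if there exists $a>0$ such that $f=\phi_a$ and $g=\phi_a$ (radial functions being identified when they differ by a positive constant factor).
   Context: Radial functions. For an integer $k\ge1$, a radial function in dimension $k$ is a function $f:(0,\infty)\to[0,\infty)$ with $f>0$ a.e. and $\mu_{k-1;f}:=\int_0^\infty r^{k-1}f(r)\,dr<\infty$. In general $\mu_{j;f}:=\int_0^\infty r^{j}f(r)\,dr$. It determines the centered spherical distribution $\mathrm P_k(\mathbf 0,\mathbf I_k,f)$ on $\mathbb R^k$ with density proportional to $f(\|\mathbf x\|)$. Only this distribution matters, so $f$ is considered up to a positive multiplicative constant. Under $\mathrm P_k(\mathbf 0,\mathbf I_k,f)$, $\|\mathbf X\|$ has density $\tilde f_k(r):=(\mu_{k-1;f})^{-1}r^{k-1}f(r)$ for $r>0$; its distribution function is denoted $\tilde F_k$ and its quantile function $\tilde F_k^{-1}$. Regularity. $f$ is assumed locally absolutely continuous on $(0,\infty)$ with a.e. derivative $f'$. Put $\varphi_f:=-f'/f$. The expectation defining $C_k(\phi,f)$ below is assumed absolutely convergent. These assumptions are made on $f$ with $k=p$ and on $g$ with $k=q$. Gaussian radial functions. $\phi(r):=\exp(-r^2/2)$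 and $\phi_a(r):=\phi(ar)$ for $a>0$. The function $f$ is Gaussian if $f=\phi_a$ for some $a>0$. $\tilde\Phi_k$ is the distribution function $\tilde F_k$ for $f=\phi$, i.e. $\tilde\Phi_k(r)=\Psi_k(r^2)$ for $r>0$, where $\Psi_k$ is the chi-square distribution function with $k$ degrees of freedom. Functionals. With $U$ uniform on $(0,1)$, $$C_k(\phi,f):=\mathrm E\big[\tilde\Phi_k^{-1}(U)\,\varphi_f(\tilde F_k^{-1}(U))\big],\qquad D_k(\phi,f):=\mathrm E\big[\tilde\Phi_k^{-1}(U)\,\tilde F_k^{-1}(U)\big].$$ Asymptotic relative efficiency. $\phi_{\mathcal N}$ denotes Wilks' Gaussian likelihood ratio test for independence of a $p$-dimensional and a $q$-dimensional random vector. $\phi_{vdW}$ denotes the van der Waerden (normal-score) rank test that rejects for large values of $$n\,\big\|\tfrac1n\sum_{i=1}^n\tilde\Phi_p^{-1}(\tfrac{R_{1i}}{n+1})\tilde\Phi_q^{-1}(\tfrac{R_{2i}}{n+1})\mathbf U_{1i}\mathbf U_{2i}'\big\|^2$$ (Frobenius norm), where $\mathbf U_{ji}$ and $R_{ji}$ are the directions, and the ranks of the norms, of the observations in the $j$-th marginal sample ($j=1,2$) after affine-equivariant standardization by root-$n$ consistent location and scatter estimators. The alternatives are the local Konijn alternatives $$\mathbf X_{1i}=(1-n^{-1/2}\delta)\mathbf Y_{1i}+n^{-1/2}\delta\,\mathbf M\mathbf Y_{2i},\qquad \mathbf X_{2i}=n^{-1/2}\delta\,\mathbf M'\mathbf Y_{1i}+(1-n^{-1/2}\delta)\mathbf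 Y_{2i},\qquad i=1,\dots,n,$$ with $\delta\in\mathbb R$, $\mathbf M$ a non-random $p\times q$ matrix, and $\mathbf Y_{1i}\sim\mathrm P_p(\mathbf 0,\mathbf I_p,f)$, $\mathbf Y_{2i}\sim\mathrm P_q(\mathbf 0,\mathbf I_q,g)$ independent. Under these alternatives the Pitman asymptotic relative efficiency of $\phi_{vdW}$ with respect to $\phi_{\mathcal N}$ does not depend on $\mathbf M$ and is given by the following formula, which is to be taken as the definition of the quantity in the claim: $$\mathrm{ARE}^{p,f}_{q,g}(\phi_{vdW}/\phi_{\mathcal N}):=\frac{1}{4p^2q^2}\Big(D_p(\phi,f)\,C_q(\phi,g)+D_q(\phi,g)\,C_p(\phi,f)\Big)^2.$$ *)

theory Defs
  imports "HOL-Probability.Probability"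
begin

text \<open>
  A radial function is a total function of type \<^typ>\<open>real \<Rightarrow> real\<close> of which only the values
  on \<open>(0, \<infinity>)\<close> are ever used; its values on \<open>(-\<infinity>, 0]\<close> are arbitrary.
\<close>

definition radial_moment :: "nat \<Rightarrow> (real \<Rightarrow> real) \<Rightarrow> real" where
  "radial_moment j f = (LBINT r:{0<..}. r ^ j * f r)"

definition finite_radial_moment :: "nat \<Rightarrow> (real \<Rightarrow> real) \<Rightarrow> bool" where
  "finite_radial_moment j f \<longleftrightarrow> set_integrable lborel {0<..} (\<lambda>r. r ^ j * f r)"

definition radial_function :: "nat \<Rightarrow> (real \<Rightarrow> real) \<Rightarrow> bool" where
  "radial_function k f \<longleftrightarrow>
     (\<forall>r>0. 0 \<le> f r) \<and>
     (AE r in lborel. 0 < r \<longrightarrow> 0 < f r) \<and>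
     finite_radial_moment (k - 1) f"

text \<open>Equality of radial functions up to a positive multiplicative constant.\<close>

definition radial_equiv :: "(real \<Rightarrow> real) \<Rightarrow> (real \<Rightarrow> real) \<Rightarrow> bool" where
  "radial_equiv f g \<longleftrightarrow> (\<exists>c>0. \<forall>r>0. f r = c * g r)"

text \<open>The distribution of the norm of \<open>X\<close> for \<open>X\<close> spherical on \<open>\<real>\<^sup>k\<close> with density
  proportional to \<open>f \<parallel>x\<parallel>\<close>.\<close>

definition radial_density :: "nat \<Rightarrow> (real \<Rightarrow> real) \<Rightarrow> real \<Rightarrow> real" where
  "radial_density k f r =
     (if 0 < r then r ^ (k - 1) * f r / radial_moment (k - 1) f else 0)"

definition radial_distr :: "nat \<Rightarrow> (real \<Rightarrow> real) \<Rightarrow> real measure" where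
  "radial_distr k f = density lborel (\<lambda>r. ennreal (radial_density k f r))"

definition radial_cdf :: "nat \<Rightarrow> (real \<Rightarrow> real) \<Rightarrow> real \<Rightarrow> real" where
  "radial_cdf k f = cdf (radial_distr k f)"

text \<open>The quantile function; it is only meaningful, and only used, for \<open>0 < u < 1\<close>.\<close>

definition radial_quantile :: "nat \<Rightarrow> (real \<Rightarrow> real) \<Rightarrow> real \<Rightarrow> real" where
  "radial_quantile k f u = Inf {r. u \<le> radial_cdf k f r}"

text \<open>
  Absolute continuity on \<open>[a, b]\<close>. The members of a division are nonempty compact intervals
  \<open>[x, y]\<close> with pairwise disjoint interiors, and \<open>x = Inf K\<close>, \<open>y = Sup K\<close>.
\<close>

definition abs_continuous_interval :: "real \<Rightarrow> real \<Rightarrow> (real \<Rightarrow> real) \<Rightarrow> bool" where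
  "abs_continuous_interval a b f \<longleftrightarrow>
     (\<forall>\<epsilon>>0. \<exists>\<delta>>0. \<forall>\<D>.
        \<D> division_of \<Union>\<D> \<and> \<Union>\<D> \<subseteq> {a..b} \<and> (\<Sum>K\<in>\<D>. Sup K - Inf K) < \<delta> \<longrightarrow>
        (\<Sum>K\<in>\<D>. \<bar>f (Sup K) - f (Inf K)\<bar>) < \<epsilon>)"

text \<open>
  Locally absolutely continuous on \<open>(0, \<infinity>)\<close>, with a.e. derivative \<^term>\<open>deriv f\<close>. The second
  conjunct is implied by the first (Lebesgue); it records that \<^term>\<open>deriv f\<close>, which has an
  unspecified value at points of non-differentiability, is an a.e. derivative of \<open>f\<close>.
\<close>

definition loc_abs_continuous :: "(real \<Rightarrow> real) \<Rightarrow> bool" where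
  "loc_abs_continuous f \<longleftrightarrow>
     (\<forall>a b. 0 < a \<and> a < b \<longrightarrow> abs_continuous_interval a b f) \<and>
     (AE r in lborel. 0 < r \<longrightarrow> (f has_real_derivative deriv f r) (at r))"

definition score :: "(real \<Rightarrow> real) \<Rightarrow> real \<Rightarrow> real" where
  "score f r = - deriv f r / f r"

definition gauss :: "real \<Rightarrow> real" where
  "gauss r = exp (- (r\<^sup>2) / 2)"

definition gauss_scaled :: "real \<Rightarrow> real \<Rightarrow> real" where
  "gauss_scaled a r = gauss (a * r)"

abbreviation unif01 :: "real measure" where
  "unif01 \<equiv> uniform_measure lborel {0<..<1}"

definition C_integrand :: "nat \<Rightarrow> (real \<Rightarrow> real) \<Rightarrow> real \<Rightarrow> real" where
  "C_integrand k f u = radial_quantile k gauss u * score f (radial_quantile k f u)"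

definition C_functional :: "nat \<Rightarrow> (real \<Rightarrow> real) \<Rightarrow> real" where
  "C_functional k f = (\<integral>u. C_integrand k f u \<partial>unif01)"

definition D_functional :: "nat \<Rightarrow> (real \<Rightarrow> real) \<Rightarrow> real" where
  "D_functional k f = (\<integral>u. radial_quantile k gauss u * radial_quantile k f u \<partial>unif01)"

definition regular_radial_function :: "nat \<Rightarrow> (real \<Rightarrow> real) \<Rightarrow> bool" where
  "regular_radial_function k f \<longleftrightarrow>
     radial_function k f \<and> loc_abs_continuous f \<and> integrable unif01 (C_integrand k f)"

text \<open>
  Pitman asymptotic relative efficiency, under local Konijn alternatives with radial functions
  \<open>f\<close> (dimension \<open>p\<close>) and \<open>g\<close> (dimension \<open>q\<close>), of the van der Waerden rank test of independence
  with respect to Wilks' Gaussian likelihood ratio test. The closed formula is the definition.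
\<close>

definition ARE_vdW :: "nat \<Rightarrow> (real \<Rightarrow> real) \<Rightarrow> nat \<Rightarrow> (real \<Rightarrow> real) \<Rightarrow> real" where
  "ARE_vdW p f q g =
     1 / (4 * (real p)\<^sup>2 * (real q)\<^sup>2) *
     (D_functional p f * C_functional q g + D_functional q g * C_functional p f)\<^sup>2"

end

theory Submission
  imports Defs
begin

text \<open>
  Write \<open>k = m + 1\<close> for the dimension, \<open>F\<close> for the distribution function of the radius \<open>R\<close>, and
  \<open>T = \<Phi>\<^sup>-\<^sup>1 \<circ> F\<close> for the increasing map that carries the law of \<open>R\<close> to the law of the Gaussian
  radius. Substituting \<open>u = F r\<close> turns both functionals into expectations over \<open>R\<close>, namely
  \<open>C = E[T R * score f R]\<close> and \<open>D = E[R * T R]\<close>. One integration by parts in each of them, the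
  first on \<open>f\<close> (the tail integral of \<open>- f'\<close>), the second on \<open>gauss \<circ> T\<close> (the tail integral of
  \<open>T * (gauss \<circ> T) * T'\<close>), gives
  \<open>C = E[T' + m * (T / R)]\<close> and \<open>D = E[1 / T' + m * (R / T)]\<close>
  (lemmas \<open>C_functional_eq\<close> and \<open>D_functional_eq\<close>).

  In this form the two functionals are expectations of the same quantities and of their
  reciprocals. Since \<open>x + 1 / x \<ge> 2\<close>, every \<open>t > 0\<close> satisfies \<open>t * C + D / t \<ge> 2 * k\<close>, and the
  choice \<open>t = sqrt (D / C)\<close> yields \<open>C * D \<ge> k\<^sup>2\<close>. Equality forces \<open>t * T' = 1\<close> almost everywhere;
  as \<open>T\<close> is the integral of \<open>T'\<close>, it is then linear, which says that \<open>f\<close> is Gaussian. Conversely a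
  Gaussian \<open>f\<close> of scale \<open>a\<close> has \<open>T r = a * r\<close>, hence \<open>C = k * a\<close> and \<open>D = k / a\<close>.

  The theorem combines the inequalities for \<open>f\<close> and \<open>g\<close> by the inequality of arithmetic and
  geometric means: the two summands of the efficiency have product at least \<open>(p * q)\<^sup>2\<close>, so their
  sum is at least \<open>2 * p * q\<close>. Equality makes both functions Gaussian, and equality of the two
  summands then forces the two scales to agree.

  The analytic work lies in the first integration by parts, where \<open>f\<close> is only locally absolutely
  continuous. It needs the fundamental theorem of calculus for such functions, and it is carried
  out by Fubini's theorem over the region \<open>0 < r < s\<close>, so that the assumed integrability of
  \<open>C_integrand\<close> is enough and no boundary values of \<open>f\<close> at \<open>0\<close> or \<open>\<infinity>\<close> have to be estimated, apart
  from \<open>f r \<longlonglongrightarrow> 0\<close> as \<open>r \<longlonglongrightarrow> \<infinity>\<close>.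
\<close>

section \<open>Absolutely continuous functions are integrals of their derivatives\<close>

text \<open>
  Two tags can share an interval only if the interval is a single point, so a sum over tagged
  intervals is a sum over the intervals as soon as the summand vanishes at points.
\<close>
lemma interval_sums_over_tags:
  fixes \<psi> :: "real set \<Rightarrow> real"
  assumes p: "p tagged_partial_division_of S"
    and degenerate: "\<And>x. \<psi> {x} = 0"
  shows "(\<Sum>(x, K)\<in>p. \<psi> K) = (\<Sum>K\<in>snd ` p. \<psi> K)"
proof -
  define \<psi>' where "\<psi>' K = (if K = {} then 0 else \<psi> K)" for K
  have ne: "K \<noteq> {}" if "(x, K) \<in> p" for x K
    using tagged_partial_division_ofD(2)[OF p that] by auto
  have "(\<Sum>(x, K)\<in>p. \<psi>' K) = (\<Sum>K\<in>snd ` p. \<psi>' K)"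
  proof (rule sum.over_tagged_division_lemma[OF tagged_partial_division_of_Union_self[OF p]])
    fix u v :: real assume "box u v = {}"
    then have "v \<le> u" by simp
    then show "\<psi>' (cbox u v) = 0"
      by (cases "u = v") (auto simp: \<psi>'_def degenerate)
  qed
  moreover have "(\<Sum>(x, K)\<in>p. \<psi>' K) = (\<Sum>(x, K)\<in>p. \<psi> K)"
    by (rule sum.cong) (auto simp: \<psi>'_def dest: ne)
  moreover have "(\<Sum>K\<in>snd ` p. \<psi>' K) = (\<Sum>K\<in>snd ` p. \<psi> K)"
    by (rule sum.cong) (auto simp: \<psi>'_def dest: ne)
  ultimately show ?thesis by simp
qed

text \<open>
  A null set has an open neighbourhood of arbitrarily small measure. Non-overlapping intervals
  inside it have small total length, hence \<open>f\<close> varies little over them. This controls the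
  intervals of a Riemann sum whose tags are points of non-differentiability.
\<close>
lemma abs_continuous_small_variation_over_null_tags:
  assumes ac: "abs_continuous_interval a b f" and N: "negligible N" and "0 < \<epsilon>"
  obtains U where "open U" "N \<subseteq> U"
    "\<And>p. p tagged_partial_division_of {a..b} \<Longrightarrow> (\<And>x K. (x, K) \<in> p \<Longrightarrow> K \<subseteq> U) \<Longrightarrow>
       (\<Sum>(x, K)\<in>p. \<bar>f (Sup K) - f (Inf K)\<bar>) < \<epsilon>"
proof -
  obtain \<delta> where "0 < \<delta>" and \<delta>: "\<And>\<D>. \<D> division_of \<Union>\<D> \<Longrightarrow> \<Union>\<D> \<subseteq> {a..b} \<Longrightarrow>
      (\<Sum>K\<in>\<D>. Sup K - Inf K) < \<delta> \<Longrightarrow> (\<Sum>K\<in>\<D>. \<bar>f (Sup K) - f (Inf K)\<bar>) < \<epsilon>"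
    using ac \<open>0 < \<epsilon>\<close> unfolding abs_continuous_interval_def by meson
  have Nl: "N \<in> null_sets lebesgue"
    using N by (simp add: negligible_iff_null_sets)
  obtain U where U: "open U" "N \<subseteq> U" "(U - N) \<in> lmeasurable" "emeasure lebesgue (U - N) < ennreal \<delta>"
    using sets_lebesgue_outer_open[of N \<delta>] Nl \<open>0 < \<delta>\<close> by blast
  have em: "emeasure lebesgue U < ennreal \<delta>"
    using emeasure_Diff_null_set[OF Nl, of U] U(1,4) by (simp add: borel_open)
  have Um: "U \<in> lmeasurable"
    using U(1) em by (intro fmeasurableI) (auto simp: borel_open intro: less_trans)
  have Ul: "measure lebesgue U < \<delta>"
    using em Um \<open>0 < \<delta>\<close> by (simp add: emeasure_eq_measure2 ennreal_less_iff)
  show thesis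
  proof (rule that[of U])
    show "open U" "N \<subseteq> U" using U by auto
    fix p assume p: "p tagged_partial_division_of {a..b}" and pU: "\<And>x K. (x, K) \<in> p \<Longrightarrow> K \<subseteq> U"
    have div: "(snd ` p) division_of \<Union>(snd ` p)"
      by (rule partial_division_of_tagged_division[OF p])
    have sub: "\<Union>(snd ` p) \<subseteq> {a..b}"
      using tagged_partial_division_ofD(3)[OF p] by fastforce
    have "(\<Sum>K\<in>snd ` p. Sup K - Inf K) = (\<Sum>K\<in>snd ` p. measure lebesgue K)"
    proof (rule sum.cong)
      fix K assume "K \<in> snd ` p"
      then obtain u v where "K = cbox u v" "K \<noteq> {}"
        using division_ofD(3,4)[OF div] by metis
      then show "Sup K - Inf K = measure lebesgue K" by (auto simp: measure_completion)
    qed simp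
    also have "\<dots> = measure lebesgue (\<Union>(snd ` p))"
      using content_division[OF div] by simp
    also have "\<dots> \<le> measure lebesgue U"
    proof (rule measure_mono_fmeasurable)
      show "\<Union>(snd ` p) \<subseteq> U" using pU by fastforce
      show "\<Union>(snd ` p) \<in> sets lebesgue"
        using lmeasurable_division[OF div] by (rule fmeasurableD)
    qed (rule Um)
    finally have "(\<Sum>K\<in>snd ` p. \<bar>f (Sup K) - f (Inf K)\<bar>) < \<epsilon>"
      using \<delta>[OF div sub] Ul by simp
    then show "(\<Sum>(x, K)\<in>p. \<bar>f (Sup K) - f (Inf K)\<bar>) < \<epsilon>"
      using interval_sums_over_tags[OF p, of "\<lambda>K. \<bar>f (Sup K) - f (Inf K)\<bar>"] by simp
  qed
qed

text \<open>
  Cousin's straddle lemma: the difference quotient over an interval containing \<open>x\<close> is close to the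
  derivative at \<open>x\<close>, whether or not \<open>x\<close> is an endpoint.
\<close>
lemma straddle_estimate:
  fixes f :: "real \<Rightarrow> real"
  assumes "(f has_real_derivative D) (at x)" and "0 < e"
  obtains d where "0 < d"
    "\<And>u v. u \<le> x \<Longrightarrow> x \<le> v \<Longrightarrow> {u..v} \<subseteq> ball x d \<Longrightarrow> \<bar>(v - u) * D - (f v - f u)\<bar> \<le> e * (v - u)"
proof -
  have "(f has_derivative (\<lambda>h. h * D)) (at x)"
    using assms(1) by (simp add: has_field_derivative_def mult.commute[of _ D])
  then obtain d where "0 < d" and d: "\<And>y. \<bar>y - x\<bar> < d \<Longrightarrow> \<bar>f y - f x - (y - x) * D\<bar> \<le> e * \<bar>y - x\<bar>"
    using \<open>0 < e\<close> unfolding has_derivative_at_alt by (auto simp: real_norm_def)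
  show thesis
  proof (rule that[OF \<open>0 < d\<close>])
    fix u v assume uv: "u \<le> x" "x \<le> v" "{u..v} \<subseteq> ball x d"
    then have "u \<in> ball x d" "v \<in> ball x d"
      by (simp_all add: subset_iff del: mem_ball)
    then have "\<bar>f u - f x - (u - x) * D\<bar> \<le> e * \<bar>u - x\<bar>" "\<bar>f v - f x - (v - x) * D\<bar> \<le> e * \<bar>v - x\<bar>"
      by (auto intro!: d simp: dist_real_def)
    with uv show "\<bar>(v - u) * D - (f v - f u)\<bar> \<le> e * (v - u)"
      by (auto simp: abs_le_iff algebra_simps)
  qed
qed

text \<open>
  The gauge integral gives the result without integrability of \<open>f'\<close> as a hypothesis. A gauge is
  chosen so that an interval tagged at a good point obeys the straddle estimate, and an interval
  tagged in the exceptional null set lies in the small open neighbourhood; the Riemann sum then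
  telescopes to \<open>f b - f a\<close> up to the two errors.
\<close>
theorem abs_continuous_FTC:
  assumes ac: "abs_continuous_interval a b f" and "a < b"
    and der: "AE x in lborel. a \<le> x \<longrightarrow> x \<le> b \<longrightarrow> (f has_real_derivative f' x) (at x)"
  shows "(f' has_integral (f b - f a)) {a..b}"
proof -
  from der obtain N where N: "N \<in> null_sets lborel"
    and derN: "\<And>x. x \<notin> N \<Longrightarrow> a \<le> x \<Longrightarrow> x \<le> b \<Longrightarrow> (f has_real_derivative f' x) (at x)"
    by (rule AE_E3) (simp add: space_lborel)
  have negN: "negligible N"
    using N by (simp add: negligible_iff_null_sets null_sets_completionI)
  \<comment> \<open>Intervals tagged in \<open>N\<close> now contribute nothing to the Riemann sum.\<close>
  define g where "g x = (if x \<in> N then 0 else f' x)" for x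
  have "(g has_integral (f b - f a)) {a..b}"
    unfolding has_integral_factor_content_real
  proof (intro allI impI)
    fix e :: real assume "0 < e"
    have "0 < e * (b - a) / 2" "0 < e / 2" using \<open>0 < e\<close> \<open>a < b\<close> by auto
    obtain U where U: "open U" "N \<subseteq> U"
      and small: "\<And>p. p tagged_partial_division_of {a..b} \<Longrightarrow> (\<And>x K. (x, K) \<in> p \<Longrightarrow> K \<subseteq> U) \<Longrightarrow>
       (\<Sum>(x, K)\<in>p. \<bar>f (Sup K) - f (Inf K)\<bar>) < e * (b - a) / 2"
      by (rule abs_continuous_small_variation_over_null_tags[OF ac negN \<open>0 < e * (b - a) / 2\<close>]) blast
    have "\<exists>d>0. (x \<in> N \<longrightarrow> ball x d \<subseteq> U) \<and> (x \<notin> N \<longrightarrow> a \<le> x \<longrightarrow> x \<le> b \<longrightarrow>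
       (\<forall>u v. u \<le> x \<longrightarrow> x \<le> v \<longrightarrow> {u..v} \<subseteq> ball x d \<longrightarrow> \<bar>(v - u) * f' x - (f v - f u)\<bar> \<le> e / 2 * (v - u)))" for x
    proof (cases "x \<in> N")
      case True
      then show ?thesis using U by (meson openE subsetD)
    next
      case False
      show ?thesis
      proof (cases "a \<le> x \<and> x \<le> b")
        case True
        show ?thesis
          by (rule straddle_estimate[OF derN[OF False] \<open>0 < e/2\<close>]) (use True False in auto)
      qed (use False in \<open>auto intro!: exI[of _ 1]\<close>)
    qed
    then obtain d where d0: "\<And>x. 0 < d x" and dN: "\<And>x. x \<in> N \<Longrightarrow> ball x (d x) \<subseteq> U"
      and dg: "\<And>x u v. x \<notin> N \<Longrightarrow> a \<le> x \<Longrightarrow> x \<le> b \<Longrightarrow> u \<le> x \<Longrightarrow> x \<le> v \<Longrightarrow> {u..v} \<subseteq> ball x (d x)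
          \<Longrightarrow> \<bar>(v - u) * f' x - (f v - f u)\<bar> \<le> e / 2 * (v - u)"
      by metis
    show "\<exists>\<gamma>. gauge \<gamma> \<and> (\<forall>p. p tagged_division_of {a..b} \<and> \<gamma> fine p \<longrightarrow>
      norm ((\<Sum>(x, K)\<in>p. measure lborel K *\<^sub>R g x) - (f b - f a)) \<le> e * measure lborel {a..b})"
    proof (intro exI conjI allI impI; (elim conjE)?)
      show "gauge (\<lambda>x. ball x (d x))" using d0 by (rule gauge_ball_dependent[rule_format])
      fix p assume p: "p tagged_division_of {a..b}" and fine: "(\<lambda>x. ball x (d x)) fine p"
      have fin: "finite p" using p by blast
      have part: "p tagged_partial_division_of {a..b}" using p by (simp add: tagged_division_of_def)
      have piece: "\<exists>u v. K = {u..v} \<and> u \<le> x \<and> x \<le> v \<and> a \<le> x \<and> x \<le> b \<and> {u..v} \<subseteq> ball x (d x)"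
        if "(x, K) \<in> p" for x K
        using tagged_division_ofD(2,3,4)[OF p that] fineD[OF fine that] by (auto) 
      let ?\<Delta> = "\<lambda>(x, K). measure lborel K *\<^sub>R g x - (f (Sup K) - f (Inf K))"
      let ?bad = "p \<inter> (N \<times> UNIV)" and ?good = "p - N \<times> UNIV"
      have tele: "f b - f a = (\<Sum>(x,K)\<in>p. f (Sup K) - f (Inf K))"
        "b - a = (\<Sum>(x,K)\<in>p. Sup K - Inf K)"
        using additive_tagged_division_1[OF less_imp_le[OF \<open>a < b\<close>] p, of f]
          additive_tagged_division_1[OF less_imp_le[OF \<open>a < b\<close>] p, of "\<lambda>x. x"] by auto
      have "(\<Sum>(x, K)\<in>p. measure lborel K *\<^sub>R g x) - (f b - f a) = sum ?\<Delta> p"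
        unfolding tele(1) by (subst sum_subtractf[symmetric]) (rule sum.cong, auto)
      also have "\<dots> = sum ?\<Delta> ?bad + sum ?\<Delta> ?good"
        using fin by (rule sum.Int_Diff)
      finally have split: "(\<Sum>(x, K)\<in>p. measure lborel K *\<^sub>R g x) - (f b - f a) = sum ?\<Delta> ?bad + sum ?\<Delta> ?good" .
      have "\<bar>sum ?\<Delta> ?bad\<bar> \<le> (\<Sum>(x, K)\<in>?bad. \<bar>f (Sup K) - f (Inf K)\<bar>)"
        by (rule order_trans[OF sum_abs], rule sum_mono) (auto simp: g_def)
      also have "\<dots> < e * (b - a) / 2"
      proof (rule small)
        show "?bad tagged_partial_division_of {a..b}"
          by (rule tagged_partial_division_subset[OF part]) simp
        fix x K assume "(x, K) \<in> ?bad"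
        then have "(x, K) \<in> p" "x \<in> N" by auto
        then show "K \<subseteq> U" using piece dN by fastforce
      qed
      finally have bad: "\<bar>sum ?\<Delta> ?bad\<bar> < e * (b - a) / 2" .
      have "\<bar>sum ?\<Delta> ?good\<bar> \<le> (\<Sum>(x, K)\<in>?good. e / 2 * (Sup K - Inf K))"
      proof (rule order_trans[OF sum_abs], rule sum_mono)
        fix z assume z: "z \<in> ?good"
        obtain x K where zx: "z = (x, K)" by force
        with z piece obtain u v where uv: "K = {u..v}" "u \<le> x" "x \<le> v" "a \<le> x" "x \<le> b" "{u..v} \<subseteq> ball x (d x)"
          by blast
        from dg[OF _ this(4,5,2,3,6)] z zx
        show "\<bar>?\<Delta> z\<bar> \<le> (case z of (x, K) \<Rightarrow> e / 2 * (Sup K - Inf K))"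
          using uv by (auto simp: g_def)
      qed
      also have "\<dots> \<le> (\<Sum>(x, K)\<in>p. e / 2 * (Sup K - Inf K))"
      proof (rule sum_mono2[OF fin])
        fix z assume "z \<in> p - ?good"
        then obtain x K where "z = (x, K)" "(x, K) \<in> p" by force
        with piece[OF this(2)] show "0 \<le> (case z of (x, K) \<Rightarrow> e / 2 * (Sup K - Inf K))"
          using \<open>0 < e\<close> by auto
      qed auto
      also have "\<dots> = e / 2 * (b - a)"
        unfolding tele(2) by (simp add: sum_distrib_left split_def)
      finally have good: "\<bar>sum ?\<Delta> ?good\<bar> \<le> e / 2 * (b - a)" .
      show "norm ((\<Sum>(x, K)\<in>p. measure lborel K *\<^sub>R g x) - (f b - f a)) \<le> e * measure lborel {a..b}"
      proof -
        have "e * measure lborel {a..b} = e * (b - a) / 2 + e / 2 * (b - a)"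
          using \<open>a < b\<close> by simp
        then show ?thesis
          unfolding split real_norm_def using bad good abs_triangle_ineq[of "sum ?\<Delta> ?bad" "sum ?\<Delta> ?good"]
          by linarith
      qed
    qed
  qed
  then show ?thesis
    by (rule has_integral_spike[OF negN, rotated]) (auto simp: g_def)
qed

lemma abs_continuous_isCont:
  assumes ac: "abs_continuous_interval a b f" and x: "a < x" "x < b"
  shows "isCont f x"
  unfolding continuous_at_eps_delta
proof (intro allI impI)
  fix e :: real assume "0 < e"
  then obtain \<delta> where "0 < \<delta>" and \<delta>: "\<And>\<D>. \<D> division_of \<Union>\<D> \<Longrightarrow> \<Union>\<D> \<subseteq> {a..b} \<Longrightarrow>
      (\<Sum>K\<in>\<D>. Sup K - Inf K) < \<delta> \<Longrightarrow> (\<Sum>K\<in>\<D>. \<bar>f (Sup K) - f (Inf K)\<bar>) < e"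
    using ac unfolding abs_continuous_interval_def by meson
  have pair: "\<bar>f v - f u\<bar> < e" if "a \<le> u" "u \<le> v" "v \<le> b" "v - u < \<delta>" for u v
  proof -
    have "{{u..v}} division_of \<Union>{{u..v}}"
      using division_of_self[of u v] that by (simp add: box_real)
    from \<delta>[OF this] that show ?thesis by auto
  qed
  show "\<exists>d>0. \<forall>y. dist y x < d \<longrightarrow> dist (f y) (f x) < e"
  proof (intro exI conjI allI impI)
    show "0 < min \<delta> (min (x - a) (b - x))" using x \<open>0 < \<delta>\<close> by auto
    fix y assume "dist y x < min \<delta> (min (x - a) (b - x))"
    then show "dist (f y) (f x) < e"
      using pair[of x y] pair[of y x] x unfolding dist_real_def by argo
  qed
qed

section \<open>Integration by parts without boundary terms\<close>

text \<open>
  With \<open>h\<close> the integral of \<open>h'\<close> from \<open>0\<close> and \<open>u\<close> the tail integral of \<open>w\<close>, both sides are the double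
  integral of \<open>w s * h' r\<close> over \<open>0 < r < s\<close>. As \<open>h' \<ge> 0\<close>, integrating \<open>\<bar>w s * h' r\<bar>\<close> over \<open>r\<close>
  first gives \<open>\<bar>w s * h s\<bar>\<close>, so integrability of \<open>w * h\<close> justifies the interchange.
\<close>
lemma Fubini_by_parts:
  fixes w h h' u :: "real \<Rightarrow> real"
  assumes meas_w: "set_borel_measurable borel {0<..} w"
    and meas_h': "set_borel_measurable borel {0<..} h'"
    and h'_nonneg: "\<And>r. 0 < r \<Longrightarrow> 0 \<le> h' r"
    and h'_int: "\<And>s. 0 < s \<Longrightarrow> set_integrable lborel {0<..<s} h'"
    and h: "\<And>s. 0 < s \<Longrightarrow> (LBINT r:{0<..<s}. h' r) = h s"
    and u: "\<And>r. 0 < r \<Longrightarrow> (LBINT s:{r<..}. w s) = u r"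
    and wh: "set_integrable lborel {0<..} (\<lambda>s. w s * h s)"
  shows "set_integrable lborel {0<..} (\<lambda>r. h' r * u r)"
    and "(LBINT r:{0<..}. h' r * u r) = (LBINT s:{0<..}. w s * h s)"
proof -
  define W where "W s = indicator {0<..} s * w s" for s :: real
  define H where "H r = indicator {0<..} r * h' r" for r :: real
  have [measurable]: "W \<in> borel_measurable borel" "H \<in> borel_measurable borel"
    using meas_w meas_h' by (simp_all add: W_def[abs_def] H_def[abs_def] set_borel_measurable_def)
  let ?g = "\<lambda>s r. W s * (H r * indicator {r<..} s)"
  have H_restrict: "H r * indicator {r<..} s = indicator {0<..<s} r * h' r" for r s
    by (auto simp: H_def indicator_def)
  have row_int: "integrable lborel (\<lambda>r. ?g s r)" for s
  proof (cases "0 < s")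
    case True
    then show ?thesis
      using h'_int[OF True] by (simp add: H_restrict set_integrable_def)
  qed (simp add: W_def)
  have row: "(\<integral>r. ?g s r \<partial>lborel) = indicator {0<..} s * (w s * h s)" for s
  proof (cases "0 < s")
    case True
    then show ?thesis
      using h[OF True] by (simp add: H_restrict set_lebesgue_integral_def W_def)
  qed (simp add: W_def)
  have row_norm: "(\<integral>r. norm (?g s r) \<partial>lborel) = norm (indicator {0<..} s * (w s * h s))" for s
  proof -
    have "norm (?g s r) = norm (W s) * (H r * indicator {r<..} s)" for r
      using h'_nonneg[of r] by (auto simp: abs_mult H_def indicator_def)
    then have "(\<integral>r. norm (?g s r) \<partial>lborel) = norm (W s) * (\<integral>r. H r * indicator {r<..} s \<partial>lborel)"
      by simp
    also have "(\<integral>r. H r * indicator {r<..} s \<partial>lborel) = (if 0 < s then h s else 0)"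
      using h[of s] by (auto simp: H_restrict set_lebesgue_integral_def)
    also have "norm (W s) * \<dots> = norm (indicator {0<..} s * (w s * h s))"
    proof (cases "0 < s")
      case True
      then have "0 \<le> h s"
        unfolding h[OF True, symmetric] set_lebesgue_integral_def
        by (intro integral_nonneg_AE AE_I2) (auto simp: indicator_def h'_nonneg)
      with True show ?thesis by (simp add: W_def abs_mult)
    qed (simp add: W_def)
    finally show ?thesis .
  qed
  have joint: "integrable (lborel \<Otimes>\<^sub>M lborel) (\<lambda>(s, r). ?g s r)"
  proof (rule lborel_pair.Fubini_integrable)
    show "(\<lambda>(s, r). ?g s r) \<in> borel_measurable (lborel \<Otimes>\<^sub>M lborel)"
    proof -
      have "(\<lambda>(s, r). ?g s r) = (\<lambda>z. W (fst z) * (H (snd z) * (if snd z < fst z then 1 else 0)))"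
        by (auto simp: indicator_def)
      then show ?thesis by simp
    qed
    show "integrable lborel (\<lambda>s. \<integral>r. norm (case (s, r) of (s, r) \<Rightarrow> ?g s r) \<partial>lborel)"
      using integrable_norm[OF wh[unfolded set_integrable_def]] by (simp only: prod.case row_norm real_scaleR_def)
    show "AE s in lborel. integrable lborel (\<lambda>r. case (s, r) of (s, r) \<Rightarrow> ?g s r)"
      using row_int by simp
  qed
  have column: "(\<integral>s. ?g s r \<partial>lborel) = indicator {0<..} r * (h' r * u r)" for r
  proof (cases "0 < r")
    case True
    have "?g s r = h' r * (indicator {r<..} s * w s)" for s
      using True by (auto simp: W_def H_def indicator_def)
    then have "(\<integral>s. ?g s r \<partial>lborel) = (\<integral>s. h' r * (indicator {r<..} s * w s) \<partial>lborel)"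
      by (simp only:)
    then show ?thesis
      using True u[OF True] by (simp add: set_lebesgue_integral_def)
  qed (simp add: H_def)
  show "set_integrable lborel {0<..} (\<lambda>r. h' r * u r)"
    using lborel_pair.integrable_snd[OF joint] by (simp add: column set_integrable_def)
  show "(LBINT r:{0<..}. h' r * u r) = (LBINT s:{0<..}. w s * h s)"
    using lborel_pair.Fubini_integral[OF joint] by (simp only: column row set_lebesgue_integral_def real_scaleR_def)
qed

lemma FTC_from_0:
  fixes H H' :: "real \<Rightarrow> real"
  assumes "0 < s"
    and deriv: "\<And>r. 0 < r \<Longrightarrow> (H has_real_derivative H' r) (at r)"
    and cont: "\<And>r. 0 < r \<Longrightarrow> isCont H' r"
    and nonneg: "\<And>r. 0 < r \<Longrightarrow> 0 \<le> H' r"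
    and lim: "(H \<longlongrightarrow> 0) (at_right 0)"
  shows "set_integrable lborel {0<..<s} H'" and "(LBINT r:{0<..<s}. H' r) = H s"
proof -
  have "(H \<longlongrightarrow> H s) (at_left s)"
    using DERIV_isCont[OF deriv[OF \<open>0 < s\<close>]] by (simp add: isCont_def filterlim_at_split)
  moreover have "ereal 0 < ereal s" using \<open>0 < s\<close> by simp
  ultimately have "set_integrable lborel (einterval (ereal 0) (ereal s)) H' \<and>
      (LBINT r=ereal 0..ereal s. H' r) = H s - 0"
    using deriv cont nonneg lim
    by (intro conjI interval_integral_FTC_nonneg[of _ _ H]) (auto simp: ereal_tendsto_simps)
  with \<open>0 < s\<close> show "set_integrable lborel {0<..<s} H'" "(LBINT r:{0<..<s}. H' r) = H s"
    by (auto simp: interval_lebesgue_integral_def)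
qed

lemma FTC_to_infinity:
  fixes H H' :: "real \<Rightarrow> real"
  assumes "0 < s"
    and deriv: "\<And>r. 0 < r \<Longrightarrow> (H has_real_derivative - H' r) (at r)"
    and cont: "\<And>r. 0 < r \<Longrightarrow> isCont H' r"
    and nonneg: "\<And>r. 0 < r \<Longrightarrow> 0 \<le> H' r"
    and lim: "(H \<longlongrightarrow> 0) at_top"
  shows "(LBINT r:{s<..}. H' r) = H s"
proof -
  have "(H \<longlongrightarrow> H s) (at_right s)"
    using DERIV_isCont[OF deriv[OF \<open>0 < s\<close>]] by (simp add: isCont_def filterlim_at_split)
  then have "((\<lambda>r. - H r) \<longlongrightarrow> - H s) (at_right s)" by (rule tendsto_minus)
  moreover have "((\<lambda>r. - H r) \<longlongrightarrow> 0) at_top" using tendsto_minus[OF lim] by simp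
  moreover have "((\<lambda>r. - H r) has_real_derivative H' r) (at r)" if "0 < r" for r
    using DERIV_minus[OF deriv[OF that]] by simp
  ultimately have "(LBINT r=ereal s..\<infinity>. H' r) = 0 - (- H s)"
    using \<open>0 < s\<close> cont nonneg
    by (intro interval_integral_FTC_nonneg(2)[of _ _ "\<lambda>r. - H r"]) (auto simp: ereal_tendsto_simps)
  then show ?thesis
    by (simp add: interval_lebesgue_integral_def)
qed

section \<open>The law of the radius and its quantile function\<close>

text \<open>
  A radial function in dimension \<open>m + 1\<close> that is continuous on \<open>(0, \<infinity>)\<close>; the shift avoids
  truncated subtraction in the exponent of the density of the radius. Continuity makes the
  distribution function \<open>F\<close> differentiable at every \<open>r > 0\<close>, and positivity almost everywhere
  makes it strictly increasing, so that the quantile function \<open>Q\<close> is a genuine inverse.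
\<close>
locale radial_profile =
  fixes m :: nat and f :: "real \<Rightarrow> real"
  assumes nonneg: "\<And>r. 0 < r \<Longrightarrow> 0 \<le> f r"
    and AE_pos: "AE r in lborel. 0 < r \<longrightarrow> 0 < f r"
    and cont: "continuous_on {0<..} f"
    and moment_finite: "finite_radial_moment m f"
begin

abbreviation "\<mu> \<equiv> radial_moment m f"
abbreviation "dens \<equiv> radial_density (Suc m) f"
abbreviation "law \<equiv> radial_distr (Suc m) f"
abbreviation "F \<equiv> radial_cdf (Suc m) f"
abbreviation "Q \<equiv> radial_quantile (Suc m) f"

lemma AE_eq_0_impossible:
  assumes "AE r in lborel. a < r \<and> r < b \<longrightarrow> f r = 0" and "0 \<le> a"
  shows "b \<le> a"
proof -
  have "AE r in lborel. \<not> (a < r \<and> r < b)"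
    using assms(1) AE_pos by eventually_elim (use assms(2) in force)
  then have "emeasure lborel {r. a < r \<and> r < b} = 0"
    by (subst (asm) AE_iff_measurable[OF _ refl]) auto
  moreover have "{r. a < r \<and> r < b} = {a<..<b}" by auto
  ultimately show ?thesis
    by (cases "a \<le> b") auto
qed

lemma moment_pos: "0 < \<mu>"
proof -
  have int: "integrable lborel (\<lambda>r. indicator {0<..} r * (r ^ m * f r))"
    using moment_finite by (simp add: finite_radial_moment_def set_integrable_def)
  have nn: "0 \<le> indicator {0<..} r * (r ^ m * f r)" for r :: real
    using nonneg[of r] by (auto simp: indicator_def)
  have "\<mu> \<noteq> 0"
  proof
    assume "\<mu> = 0"
    then have "AE r in lborel. indicator {0<..} r * (r ^ m * f r) = 0"
      using integral_nonneg_eq_0_iff_AE[OF int] nn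
      by (simp add: radial_moment_def set_lebesgue_integral_def)
    then have "AE r in lborel. 0 < r \<and> r < 1 \<longrightarrow> f r = 0"
      by eventually_elim auto
    from AE_eq_0_impossible[OF this] show False by simp
  qed
  moreover have "0 \<le> \<mu>"
    using nn by (simp add: radial_moment_def set_lebesgue_integral_def)
  ultimately show ?thesis by simp
qed

lemma dens_eq: "dens r = indicator {0<..} r * (r ^ m * f r) / \<mu>"
  by (simp add: radial_density_def indicator_def)

lemma dens_integrable: "integrable lborel dens"
  using moment_finite unfolding dens_eq[abs_def]
  by (simp add: finite_radial_moment_def set_integrable_def)

lemma dens_measurable [measurable]: "dens \<in> borel_measurable borel"
  using borel_measurable_integrable[OF dens_integrable] by simp

lemma dens_nonneg: "0 \<le> dens r"
  using nonneg[of r] moment_pos by (auto simp: dens_eq indicator_def)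

lemma integral_dens: "(\<integral>r. dens r \<partial>lborel) = 1"
  using moment_pos unfolding dens_eq[abs_def]
  by (simp add: radial_moment_def set_lebesgue_integral_def)

lemma dens_isCont: "0 < r \<Longrightarrow> isCont dens r"
proof -
  assume "0 < r"
  have "continuous_on {0<..} (\<lambda>r. r ^ m * f r / \<mu>)"
    using moment_pos by (intro continuous_intros cont) auto
  then have "continuous_on {0<..} dens"
    by (rule continuous_on_cong[THEN iffD1, rotated -1]) (auto simp: dens_eq)
  then show ?thesis
    using \<open>0 < r\<close> by (simp add: continuous_on_eq_continuous_at)
qed

lemma AE_dens_pos: "AE r in lborel. 0 < r \<longrightarrow> 0 < dens r"
  using AE_pos by eventually_elim (use moment_pos in \<open>auto simp: dens_eq\<close>)

sublocale law: real_distribution law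
proof -
  have "emeasure law (space law) = 1"
    using integral_dens dens_integrable
    by (simp add: radial_distr_def emeasure_density nn_integral_eq_integral dens_nonneg)
  then show "real_distribution law"
    by (intro real_distribution.intro prob_spaceI real_distribution_axioms.intro)
       (auto simp: radial_distr_def)
qed

lemma integral_law:
  fixes g :: "real \<Rightarrow> real"
  assumes "g \<in> borel_measurable borel"
  shows "(\<integral>r. g r \<partial>law) = (\<integral>r. dens r * g r \<partial>lborel)"
  using assms unfolding radial_distr_def by (intro integral_real_density) (auto simp: dens_nonneg)

lemma integrable_law:
  fixes g :: "real \<Rightarrow> real"
  assumes "g \<in> borel_measurable borel"
  shows "integrable law g \<longleftrightarrow> integrable lborel (\<lambda>r. dens r * g r)"
  using assms unfolding radial_distr_def by (intro integrable_real_density) (auto simp: dens_nonneg)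

lemma AE_law_pos: "AE r in law. 0 < r"
proof -
  have "(\<lambda>r. ennreal (dens r)) \<in> borel_measurable lborel" by measurable
  moreover have "0 < ennreal (dens r) \<longrightarrow> 0 < r" for r
    by (cases "0 < r") (simp_all add: radial_density_def)
  ultimately show ?thesis
    unfolding radial_distr_def by (simp add: AE_density)
qed

lemma F_measurable [measurable]: "F \<in> borel_measurable borel"
  unfolding radial_cdf_def by (intro borel_measurable_mono monoI law.cdf_nondecreasing)

lemma F_diff: "a \<le> b \<Longrightarrow> F b - F a = (LBINT r:{a..b}. dens r)"
proof -
  assume "a \<le> b"
  have "F b - F a = measure law {a<..b}"
  proof (cases "a = b")
    case False
    then show ?thesis using law.cdf_diff_eq[of a b] \<open>a \<le> b\<close> by (simp add: radial_cdf_def)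
  qed simp
  also have "\<dots> = (\<integral>r. indicator {a<..b} r \<partial>law)" by simp
  also have "\<dots> = (\<integral>r. dens r * indicator {a<..b} r \<partial>lborel)" by (rule integral_law) simp
  also have "\<dots> = (\<integral>r. indicator {a..b} r * dens r \<partial>lborel)"
  proof (rule integral_cong_AE)
    have "AE r in lborel. r \<noteq> a" by (rule AE_lborel_singleton)
    then show "AE r in lborel. dens r * indicator {a<..b} r = indicator {a..b} r * dens r"
      by eventually_elim (auto simp: indicator_def)
  qed auto
  finally show ?thesis by (simp add: set_lebesgue_integral_def)
qed

lemma F_nonpos: "r \<le> 0 \<Longrightarrow> F r = 0"
proof -
  assume "r \<le> 0"
  have "F r = (\<integral>x. indicator {..r} x \<partial>law)"
    by (simp add: radial_cdf_def cdf_def2)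
  also have "\<dots> = (\<integral>x. dens x * indicator {..r} x \<partial>lborel)" by (rule integral_law) simp
  also have "\<dots> = 0"
    using \<open>r \<le> 0\<close> by (intro integral_eq_zero_AE AE_I2) (auto simp: dens_eq indicator_def)
  finally show ?thesis .
qed

lemma F_less: "0 \<le> a \<Longrightarrow> a < b \<Longrightarrow> F a < F b"
proof -
  assume ab: "0 \<le> a" "a < b"
  have int: "integrable lborel (\<lambda>r. indicator {a..b} r * dens r)"
    using integrable_mult_indicator[OF _ dens_integrable, of "{a..b}"] by simp
  have nn: "AE r in lborel. 0 \<le> indicator {a..b} r * dens r"
    by (auto simp: dens_nonneg)
  have "F b - F a \<noteq> 0"
  proof
    assume "F b - F a = 0"
    then have "AE r in lborel. indicator {a..b} r * dens r = 0"
      using ab F_diff[of a b] integral_nonneg_eq_0_iff_AE[OF int nn]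
      by (simp add: set_lebesgue_integral_def)
    then have "AE r in lborel. a < r \<and> r < b \<longrightarrow> f r = 0"
      by eventually_elim (use ab moment_pos in \<open>auto simp: dens_eq\<close>)
    from AE_eq_0_impossible[OF this] ab show False by simp
  qed
  moreover have "F a \<le> F b"
    unfolding radial_cdf_def using ab by (intro law.cdf_nondecreasing) simp
  ultimately show ?thesis by simp
qed

lemma F_less_iff: "0 \<le> a \<Longrightarrow> 0 \<le> b \<Longrightarrow> F a < F b \<longleftrightarrow> a < b"
  by (metis F_less linorder_less_linear order_less_asym)

lemma F_pos: "0 < r \<Longrightarrow> 0 < F r"
  using F_less[of 0 r] F_nonpos[of 0] by simp

lemma F_less_1: "F r < 1"
proof -
  have "F r \<le> F (max r 0)" unfolding radial_cdf_def by (rule law.cdf_nondecreasing) simp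
  also have "\<dots> < F (max r 0 + 1)" by (rule F_less) auto
  also have "\<dots> \<le> 1" unfolding radial_cdf_def by (rule law.cdf_bounded_prob)
  finally show ?thesis .
qed

lemma F_tendsto_0: "(F \<longlongrightarrow> 0) (at_right 0)"
  using law.cdf_is_right_cont[of 0] F_nonpos[of 0] by (simp add: radial_cdf_def continuous_within)

lemma F_tendsto_1: "(F \<longlongrightarrow> 1) at_top"
  unfolding radial_cdf_def by (rule law.cdf_lim_at_top_prob)

lemma F_has_derivative: "0 < r \<Longrightarrow> (F has_real_derivative dens r) (at r)"
proof -
  assume "0 < r"
  define a b where "a = r / 2" and "b = 2 * r"
  have ab: "0 < a" "a < r" "r < b" using \<open>0 < r\<close> by (auto simp: a_def b_def)
  have "continuous_on {a..b} dens"
    using ab by (intro continuous_at_imp_continuous_on ballI dens_isCont) auto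
  then have "((\<lambda>x. integral {a..x} dens) has_real_derivative dens r) (at r within {a..b})"
    using ab by (intro integral_has_real_derivative) auto
  then have "((\<lambda>x. integral {a..x} dens) has_real_derivative dens r) (at r)"
    using ab by (simp add: at_within_Icc_at)
  then have "((\<lambda>x. F a + integral {a..x} dens) has_real_derivative dens r) (at r)"
    by (auto intro!: derivative_eq_intros)
  moreover have F_eq: "F x = F a + integral {a..x} dens" if "x \<in> {a<..<b}" for x
  proof -
    have "set_integrable lborel {a..x} dens"
      using integrable_mult_indicator[OF _ dens_integrable, of "{a..x}"] by (simp add: set_integrable_def)
    from set_borel_integral_eq_integral(2)[OF this] F_diff[of a x] that show ?thesis by simp
  qed
  ultimately show ?thesis
    using has_field_derivative_transform_within_open[of _ "dens r" r "{a<..<b}" F] ab by simp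
qed

lemma F_surj: "0 < u \<Longrightarrow> u < 1 \<Longrightarrow> \<exists>r>0. F r = u"
proof -
  assume u: "0 < u" "u < 1"
  have "eventually (\<lambda>r. F r < u \<and> 0 < r) (at_right 0)"
    using order_tendstoD(2)[OF F_tendsto_0 u(1)] eventually_at_right_less by (rule eventually_conj)
  then obtain a where a: "F a < u" "0 < a"
    by (auto dest: eventually_happens)
  have "eventually (\<lambda>r. u < F r \<and> a < r) at_top"
    using order_tendstoD(1)[OF F_tendsto_1 u(2)] eventually_gt_at_top by (rule eventually_conj)
  then obtain b where b: "u < F b" "a < b"
    by (auto dest: eventually_happens)
  have "\<exists>r. a \<le> r \<and> r \<le> b \<and> F r = u"
    using a b by (intro IVT allI impI DERIV_isCont[OF F_has_derivative]) auto
  then obtain r where "a \<le> r" "F r = u" by auto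
  with a(2) show ?thesis by (intro exI[of _ r]) auto
qed

lemma Q_F: "0 < r \<Longrightarrow> Q (F r) = r"
proof -
  assume "0 < r"
  have "F r \<le> F x \<longleftrightarrow> r \<le> x" for x
  proof (cases "0 \<le> x")
    case True
    then show ?thesis using F_less_iff[of x r] \<open>0 < r\<close> by (meson less_le not_le)
  next
    case False
    then show ?thesis using F_nonpos[of x] F_pos[OF \<open>0 < r\<close>] \<open>0 < r\<close> by simp
  qed
  then have "{x. F r \<le> F x} = {r..}" by auto
  then show ?thesis by (simp add: radial_quantile_def)
qed

lemma Q_pos: "0 < u \<Longrightarrow> u < 1 \<Longrightarrow> 0 < Q u" and F_Q: "0 < u \<Longrightarrow> u < 1 \<Longrightarrow> F (Q u) = u"
  using F_surj[of u] Q_F by auto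

text \<open>
  Off \<open>(0, 1)\<close> the quantile is an infimum of the empty or the full set, or is taken at the single
  point \<open>1\<close>. On each of the four pieces it is monotone.
\<close>
lemma Q_measurable [measurable]: "Q \<in> borel_measurable borel"
proof (rule measurable_piecewise_restrict)
  let ?C = "{{..0}, {0<..<1}, {1}, {1<..}} :: real set set"
  show "countable ?C" by simp
  show "space borel \<subseteq> \<Union>?C"
  proof
    fix x :: real
    have "x \<le> 0 \<or> 0 < x \<and> x < 1 \<or> x = 1 \<or> 1 < x" by linarith
    then show "x \<in> \<Union>?C" by fastforce
  qed
  fix \<Omega> assume \<Omega>: "\<Omega> \<in> ?C"
  then show "\<Omega> \<inter> space borel \<in> sets borel" by auto
  have F_bounds: "0 \<le> F r" "F r < 1" for r
    using F_less_1 law.cdf_nonneg[of r] by (auto simp: radial_cdf_def)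
  have "mono_on \<Omega> Q"
    using \<Omega>
  proof (elim insertE emptyE)
    assume "\<Omega> = {0<..<1}"
    moreover have "Q u \<le> Q v" if "0 < u" "u \<le> v" "v < 1" for u v
      using that F_less_iff[of "Q v" "Q u"] F_Q[of u] F_Q[of v] Q_pos[of u] Q_pos[of v]
      by (auto simp: not_le[symmetric])
    ultimately show ?thesis by (auto simp: mono_on_def)
  next
    assume "\<Omega> = {..0}"
    then have "Q u = Inf UNIV" if "u \<in> \<Omega>" for u
      unfolding radial_quantile_def using F_bounds that by (intro arg_cong[where f=Inf]) (auto intro: order_trans)
    then show ?thesis by (simp add: mono_on_def)
  next
    assume "\<Omega> = {1<..}"
    then have "Q u = Inf {}" if "u \<in> \<Omega>" for u
      unfolding radial_quantile_def using F_bounds that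
      by (intro arg_cong[where f=Inf]) (auto simp: not_le intro: less_trans)
    then show ?thesis by (simp add: mono_on_def)
  qed (auto simp: mono_on_def)
  then show "Q \<in> borel_measurable (restrict_space borel \<Omega>)"
    by (rule borel_measurable_mono_on_fnc)
qed

text \<open>The probability integral transform: \<open>F R\<close> is uniform on \<open>(0, 1)\<close>.\<close>
lemma cdf_law_comp_F: "cdf (distr law borel F) x = max 0 (min x 1)"
proof -
  have "cdf (distr law borel F) x = measure law {r. F r \<le> x}"
  proof -
    have "F \<in> measurable law borel" "space law = UNIV" by (simp_all add: radial_distr_def)
    then show ?thesis unfolding cdf_def2 by (simp add: measure_distr vimage_def)
  qed
  also have "\<dots> = max 0 (min x 1)"
  proof -
    consider "x \<le> 0" | "0 < x" "x < 1" | "1 \<le> x" by linarith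
    then show ?thesis
    proof cases
      case 1
      have "AE r in law. \<not> F r \<le> x"
        using AE_law_pos by eventually_elim (use F_pos 1 in force)
      then have "measure law {r. F r \<le> x} = 0"
        by (subst law.prob_eq_0) (auto simp: radial_distr_def)
      then show ?thesis using 1 by simp
    next
      case 2
      have "F r \<le> x \<longleftrightarrow> r \<le> Q x" for r
      proof (cases "0 \<le> r")
        case True
        then show ?thesis using F_less_iff[of "Q x" r] Q_pos[OF 2] F_Q[OF 2] by (simp add: not_less[symmetric])
      next
        case False
        then show ?thesis using F_nonpos[of r] Q_pos[OF 2] 2 by simp
      qed
      then have "{r. F r \<le> x} = {..Q x}" by auto
      then have "measure law {r. F r \<le> x} = F (Q x)"
        by (simp add: radial_cdf_def cdf_def2)
      then show ?thesis using F_Q[OF 2] 2 by simp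
    next
      case 3
      then have "{r. F r \<le> x} = space law"
        using F_less_1 by (auto simp: radial_distr_def intro: less_imp_le less_le_trans)
      then show ?thesis using 3 law.prob_space by simp
    qed
  qed
  finally show ?thesis .
qed

lemma distr_law_F: "distr law borel F = unif01"
proof (rule cdf_unique)
  show "real_distribution (distr law borel F)"
    by (intro law.real_distribution_distr) (simp add: radial_distr_def)
  interpret U: prob_space unif01
    by (rule prob_space_uniform_measure) auto
  show "real_distribution unif01"
    by standard auto
  show "cdf (distr law borel F) = cdf unif01"
  proof
    fix x
    have "{0<..<1} \<inter> {..x} = (if x < 1 then {0<..x} else {0<..<1})" for x :: real by auto
    then have "cdf unif01 x = max 0 (min x 1)"
      unfolding cdf_def2 by (subst measure_uniform_measure) (auto simp: max_def min_def)
    then show "cdf (distr law borel F) x = cdf unif01 x"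
      by (simp add: cdf_law_comp_F)
  qed
qed

text \<open>
  Substitution \<open>u = F r\<close>: an integral over the uniform variable becomes one over the radius, where
  the density and the score have explicit formulas.
\<close>
lemma integral_unif01:
  fixes g :: "real \<Rightarrow> real"
  assumes "g \<in> borel_measurable borel"
  shows "(\<integral>u. g u \<partial>unif01) = (\<integral>r. dens r * g (F r) \<partial>lborel)"
    and "integrable unif01 g \<longleftrightarrow> integrable lborel (\<lambda>r. dens r * g (F r))"
proof -
  have [measurable]: "F \<in> measurable law borel" by (simp add: radial_distr_def)
  note [measurable] = assms
  show "(\<integral>u. g u \<partial>unif01) = (\<integral>r. dens r * g (F r) \<partial>lborel)"
    unfolding distr_law_F[symmetric] by (subst integral_distr) (auto intro!: integral_law)
  show "integrable unif01 g \<longleftrightarrow> integrable lborel (\<lambda>r. dens r * g (F r))"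
    unfolding distr_law_F[symmetric] by (subst integrable_distr_eq) (auto intro!: integrable_law)
qed

text \<open>
  A positive limit of \<open>f\<close> would bound the density \<open>dens\<close> from below near \<open>\<infinity>\<close> by some \<open>c > 0\<close>, and \<open>F\<close>
  would grow by at least \<open>1\<close> over an interval of length \<open>1 / c\<close>.
\<close>
lemma limit_at_top_eq_0:
  assumes lim: "(f \<longlongrightarrow> L) at_top"
  shows "L = 0"
proof (rule ccontr)
  assume "L \<noteq> 0"
  have "eventually (\<lambda>r. 0 \<le> f r) at_top"
    using eventually_gt_at_top[of 0] by eventually_elim (rule nonneg)
  then have "0 \<le> L" using tendsto_lowerbound[OF lim] by simp
  with \<open>L \<noteq> 0\<close> have "0 < L" by simp
  then have "eventually (\<lambda>r. L / 2 < f r) at_top"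
    by (intro order_tendstoD(1)[OF lim]) simp
  then obtain B where B: "\<And>r. B \<le> r \<Longrightarrow> L / 2 < f r"
    by (auto simp: eventually_at_top_linorder)
  define b c where "b = max B 1" and "c = L / 2 / \<mu>"
  have "0 < c" using \<open>0 < L\<close> moment_pos by (simp add: c_def)
  have "1 \<le> b" by (simp add: b_def)
  have dens_ge: "c \<le> dens r" if "b \<le> r" for r
  proof -
    have "1 \<le> r" "L / 2 \<le> f r" using that B[of r] by (auto simp: b_def)
    then have "1 * (L / 2) \<le> r ^ m * f r"
      using \<open>0 < L\<close> by (intro mult_mono) auto
    then show ?thesis
      using \<open>1 \<le> r\<close> moment_pos divide_right_mono[of "L / 2" "r ^ m * f r" \<mu>]
      by (simp add: c_def radial_density_def)
  qed
  obtain z where z: "b < z" "F (b + 1 / c) - F b = (b + 1 / c - b) * dens z"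
  proof -
    have "\<exists>z. b < z \<and> z < b + 1 / c \<and> F (b + 1 / c) - F b = (b + 1 / c - b) * dens z"
      using \<open>0 < c\<close> \<open>1 \<le> b\<close> by (intro MVT2 F_has_derivative) auto
    then show ?thesis using that by blast
  qed
  have "1 = 1 / c * c" using \<open>0 < c\<close> by simp
  also have "\<dots> \<le> 1 / c * dens z"
    using dens_ge[of z] z(1) \<open>0 < c\<close> by (intro mult_left_mono) auto
  also have "\<dots> = F (b + 1 / c) - F b" using z(2) by simp
  also have "\<dots> < 1" using F_less_1[of "b + 1 / c"] F_pos[of b] \<open>1 \<le> b\<close> by simp
  finally show False by simp
qed

lemma Q_isCont: "0 < u \<Longrightarrow> u < 1 \<Longrightarrow> isCont Q u"
proof -
  assume u: "0 < u" "u < 1"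
  have "isCont Q (F (Q u))"
  proof (rule isCont_inverse_function[where d = "Q u / 2" and f = F and x = "Q u"])
    show "0 < Q u / 2" using Q_pos[OF u] by simp
    fix z assume "\<bar>z - Q u\<bar> \<le> Q u / 2"
    then have "0 < z" using Q_pos[OF u] by linarith
    then show "Q (F z) = z" "isCont F z"
      using Q_F DERIV_isCont[OF F_has_derivative] by auto
  qed
  then show ?thesis by (simp add: F_Q[OF u])
qed

lemma Q_has_derivative:
  assumes "0 < u" "u < 1" "dens (Q u) \<noteq> 0"
  shows "(Q has_real_derivative inverse (dens (Q u))) (at u)"
  by (rule DERIV_inverse_function[of F _ _ _ 0 1])
     (use assms in \<open>auto intro: F_has_derivative Q_pos F_Q Q_isCont\<close>)

end

lemma finite_radial_moment_gauss: "finite_radial_moment j gauss"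
proof -
  have "integrable lborel (\<lambda>x. sqrt (2 * pi) * (std_normal_density x * x ^ j))"
    using integrable_std_normal_moment by (rule integrable_mult_right)
  then have "integrable lborel (\<lambda>x. x ^ j * gauss x)"
    by (simp add: std_normal_density_def gauss_def mult_ac)
  then show ?thesis
    unfolding finite_radial_moment_def set_integrable_def by (rule integrable_mult_indicator[rotated]) simp
qed

lemma gauss_pos: "0 < gauss r"
  by (simp add: gauss_def)

lemma gauss_has_derivative: "(gauss has_real_derivative - r * gauss r) (at r)"
  unfolding gauss_def[abs_def] by (auto intro!: derivative_eq_intros simp: power2_eq_square)

lemma gauss_tendsto_0: "(gauss \<longlongrightarrow> 0) at_top"
  unfolding gauss_def[abs_def] by real_asymp

lemma radial_profile_gauss: "radial_profile m gauss"
proof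
  show "continuous_on {0<..} gauss"
    unfolding gauss_def[abs_def] by (intro continuous_intros) auto
qed (auto simp: gauss_pos less_imp_le finite_radial_moment_gauss)

section \<open>The monotone map to the Gaussian radius\<close>

locale gaussian_transport = radial_profile m f + G: radial_profile m gauss for m f
begin

definition T :: "real \<Rightarrow> real" where "T r = G.Q (F r)"

text \<open>
  This is the derivative of \<open>T\<close>, by the change-of-variables relation
  \<open>dens r = G.dens (T r) * T' r\<close>.
\<close>
definition T' :: "real \<Rightarrow> real" where "T' r = dens r / G.dens (T r)"

lemma T_pos: "0 < r \<Longrightarrow> 0 < T r"
  unfolding T_def by (intro G.Q_pos F_pos F_less_1)

lemma G_F_T: "0 < r \<Longrightarrow> G.F (T r) = F r"
  unfolding T_def by (intro G.F_Q F_pos F_less_1)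

lemma G_dens_pos: "0 < z \<Longrightarrow> 0 < G.dens z"
  using G.moment_pos gauss_pos by (simp add: radial_density_def)

lemma T_measurable [measurable]: "T \<in> borel_measurable borel"
  unfolding T_def[abs_def] by measurable

lemma T'_measurable [measurable]: "T' \<in> borel_measurable borel"
  unfolding T'_def[abs_def] by measurable

lemma T_has_derivative: "0 < r \<Longrightarrow> (T has_real_derivative T' r) (at r)"
proof -
  assume "0 < r"
  have "(G.Q has_real_derivative inverse (G.dens (T r))) (at (F r))"
    using G_dens_pos[OF T_pos[OF \<open>0 < r\<close>]] \<open>0 < r\<close> unfolding T_def
    by (intro G.Q_has_derivative F_pos F_less_1) auto
  from DERIV_chain2[OF this F_has_derivative[OF \<open>0 < r\<close>]] show ?thesis
    by (simp add: T_def[abs_def, symmetric] T'_def divide_inverse mult.commute)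
qed

lemma T_isCont: "0 < r \<Longrightarrow> isCont T r"
  by (rule DERIV_isCont[OF T_has_derivative])

lemma T'_isCont: "0 < r \<Longrightarrow> isCont T' r"
proof -
  assume r: "0 < r"
  have "isCont (\<lambda>r. G.dens (T r)) r"
    by (rule isCont_o2[OF T_isCont[OF r] G.dens_isCont[OF T_pos[OF r]]])
  then show ?thesis
    unfolding T'_def[abs_def] using G_dens_pos[OF T_pos[OF r]] dens_isCont[OF r]
    by (intro continuous_intros) auto
qed

lemma dens_eq_T': "0 < r \<Longrightarrow> dens r = G.dens (T r) * T' r"
  using G_dens_pos[OF T_pos[of r]] by (simp add: T'_def)

lemma T'_nonneg: "0 < r \<Longrightarrow> 0 \<le> T' r"
  using G_dens_pos[OF T_pos[of r]] dens_nonneg[of r] by (simp add: T'_def)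

lemma AE_T'_pos: "AE r in lborel. 0 < r \<longrightarrow> 0 < T' r"
  using AE_dens_pos by eventually_elim (use G_dens_pos[OF T_pos] in \<open>auto simp: T'_def\<close>)

lemma T_mono: "0 < r \<Longrightarrow> r \<le> s \<Longrightarrow> T r \<le> T s"
  using G.F_less_iff[of "T s" "T r"] F_less_iff[of s r] T_pos[of r] T_pos[of s] G_F_T[of r] G_F_T[of s]
  by (simp add: not_less[symmetric])

lemma T_tendsto_0: "(T \<longlongrightarrow> 0) (at_right 0)"
proof (rule order_tendstoI)
  fix a :: real assume "a < 0"
  show "eventually (\<lambda>r. a < T r) (at_right 0)"
    using eventually_at_right_less[of 0]
    by eventually_elim (use T_pos \<open>a < 0\<close> in \<open>auto intro: less_trans\<close>)
next
  fix a :: real assume "0 < a"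
  show "eventually (\<lambda>r. T r < a) (at_right 0)"
    using eventually_at_right_less[of 0] order_tendstoD(2)[OF F_tendsto_0 G.F_pos[OF \<open>0 < a\<close>]]
  proof eventually_elim
    case (elim r)
    then show ?case using G.F_less_iff[of "T r" a] \<open>0 < a\<close> T_pos[of r] G_F_T[of r] by simp
  qed
qed

lemma T_at_top: "filterlim T at_top at_top"
  unfolding filterlim_at_top
proof
  fix Z
  show "eventually (\<lambda>r. Z \<le> T r) at_top"
    using eventually_gt_at_top[of 0] order_tendstoD(1)[OF F_tendsto_1 G.F_less_1[of "max Z 0"]]
  proof eventually_elim
    case (elim r)
    then show ?case using G.F_less_iff[of "max Z 0" "T r"] T_pos[of r] G_F_T[of r] by simp
  qed
qed

text \<open>
  The factor \<open>T r ^ m / T r\<close> replaces \<open>T r ^ (m - 1)\<close> and so covers \<open>m = 0\<close> as well.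
\<close>
lemma power_T_has_derivative:
  "0 < r \<Longrightarrow> ((\<lambda>r. T r ^ m) has_real_derivative real m * T r ^ m / T r * T' r) (at r)"
  by (rule DERIV_cong[OF DERIV_power[OF T_has_derivative]])
     (use T_pos[of r] in \<open>cases m; simp\<close>)+

lemma power_has_derivative:
  "0 < r \<Longrightarrow> ((\<lambda>r::real. r ^ m) has_real_derivative real m * r ^ m / r) (at r)"
  by (rule DERIV_cong[OF DERIV_pow]) (cases m; simp)

text \<open>
  \<open>T R\<close> is distributed as the Gaussian radius, whose second moment is finite. Together with the
  second moment of \<open>R\<close> this makes \<open>R * T R\<close> integrable.
\<close>
lemma integrable_dens_T_squared: "integrable lborel (\<lambda>r. dens r * (T r)\<^sup>2)"
proof -
  have "integrable lborel (\<lambda>z. G.dens z * (G.Q (G.F z))\<^sup>2) \<longleftrightarrow> integrable lborel (\<lambda>z. G.dens z * z\<^sup>2)"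
    by (rule Bochner_Integration.integrable_cong) (auto simp: G.Q_F radial_density_def)
  moreover have "integrable lborel (\<lambda>z. G.dens z * z\<^sup>2)"
    using finite_radial_moment_gauss[of "m + 2"] G.moment_pos
    unfolding G.dens_eq[abs_def] finite_radial_moment_def set_integrable_def
    by (simp add: power_add power2_eq_square mult_ac)
  ultimately have "integrable unif01 (\<lambda>u. (G.Q u)\<^sup>2)"
    by (subst G.integral_unif01(2)) auto
  then show ?thesis
    by (subst (asm) integral_unif01(2)) (auto simp: T_def)
qed

text \<open>
  In \<open>E[R * T R]\<close> the density is \<open>T ^ m * gauss T * T' / \<nu>\<close>, and \<open>T * gauss T * T'\<close> is the derivative
  of \<open>- gauss T\<close>. Integration by parts moves the derivative to \<open>T ^ m * r\<close>, which gives the two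
  summands; dividing by \<open>T'\<close> turns the Gaussian weight back into the density of the radius.
\<close>
lemma D_functional_eq:
  assumes "finite_radial_moment (m + 2) f"
  shows "integrable lborel (\<lambda>r. dens r * (1 / T' r + real m * (r / T r)))"
    and "D_functional (Suc m) f = (\<integral>r. dens r * (1 / T' r + real m * (r / T r)) \<partial>lborel)"
proof -
  let ?\<nu> = "radial_moment m gauss"
  let ?w = "\<lambda>s. T s * gauss (T s) * T' s" and ?h = "\<lambda>s. T s ^ m * s"
  let ?h' = "\<lambda>s. T s ^ m * (1 + real m * (s * T' s / T s))"
  have gauss_meas [measurable]: "gauss \<in> borel_measurable borel"
    unfolding gauss_def[abs_def] by measurable
  have sq: "integrable lborel (\<lambda>r. dens r * r\<^sup>2)"
    using assms moment_pos
    unfolding dens_eq[abs_def] finite_radial_moment_def set_integrable_def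
    by (simp add: power_add power2_eq_square mult_ac)
  have int: "integrable lborel (\<lambda>r. dens r * (T r * r))"
  proof (rule Bochner_Integration.integrable_bound)
    show "integrable lborel (\<lambda>r. dens r * (T r)\<^sup>2 + dens r * r\<^sup>2)"
      by (intro Bochner_Integration.integrable_add integrable_dens_T_squared sq)
    have "\<bar>T r * r\<bar> \<le> (T r)\<^sup>2 + r\<^sup>2" for r
      using sum_squares_bound[of "\<bar>T r\<bar>" "\<bar>r\<bar>"] mult_nonneg_nonneg[of "\<bar>T r\<bar>" "\<bar>r\<bar>"]
      unfolding abs_mult power2_abs by linarith
    then show "AE r in lborel. norm (dens r * (T r * r)) \<le> norm (dens r * (T r)\<^sup>2 + dens r * r\<^sup>2)"
      using dens_nonneg by (auto simp: abs_mult distrib_left[symmetric] intro!: mult_left_mono)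
  qed simp
  have wh_eq: "?w s * ?h s = ?\<nu> * (dens s * (T s * s))" if "0 < s" for s
    using that dens_eq_T'[OF that] T_pos[OF that] G.moment_pos by (simp add: radial_density_def)
  have wh_ind: "indicator {0<..} s * (?w s * ?h s) = ?\<nu> * (dens s * (T s * s))" for s
    by (cases "0 < s") (simp_all only: wh_eq, auto simp: radial_density_def)
  have h'_deriv: "(?h has_real_derivative ?h' r) (at r)" if "0 < r" for r
    by (rule DERIV_cong[OF DERIV_mult[OF power_T_has_derivative[OF that] DERIV_ident]])
       (use T_pos[OF that] in \<open>simp add: field_simps\<close>)
  have h'_cont: "isCont ?h' r" if "0 < r" for r
    using T_pos[OF that] by (intro continuous_intros T_isCont T'_isCont that) auto
  have h'_nonneg: "0 \<le> ?h' r" if "0 < r" for r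
    using T_pos[OF that] T'_nonneg[OF that] that by simp
  have h_lim: "(?h \<longlongrightarrow> 0) (at_right 0)"
    using tendsto_mult[OF tendsto_power[OF T_tendsto_0] tendsto_ident_at[of 0 "{0<..}"], of m] by simp
  have u_deriv: "((\<lambda>r. gauss (T r)) has_real_derivative - ?w r) (at r)" if "0 < r" for r
    by (rule DERIV_cong[OF DERIV_chain2[OF gauss_has_derivative T_has_derivative[OF that]]]) simp
  have w_cont: "isCont ?w r" if "0 < r" for r
    by (intro continuous_intros T_isCont T'_isCont that
        isCont_o2[OF T_isCont[OF that] DERIV_isCont[OF gauss_has_derivative]])
  have w_nonneg: "0 \<le> ?w r" if "0 < r" for r
    using T_pos[OF that] T'_nonneg[OF that] gauss_pos[of "T r"] by simp
  have wh: "set_integrable lborel {0<..} (\<lambda>s. ?w s * ?h s)"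
    unfolding set_integrable_def real_scaleR_def wh_ind using int by simp
  have meas: "set_borel_measurable borel {0<..} ?w" "set_borel_measurable borel {0<..} ?h'"
    by (simp_all add: set_borel_measurable_def)
  have parts: "set_integrable lborel {0<..} (\<lambda>r. ?h' r * gauss (T r))"
    "(LBINT r:{0<..}. ?h' r * gauss (T r)) = (LBINT s:{0<..}. ?w s * ?h s)"
    by (rule Fubini_by_parts[OF meas h'_nonneg FTC_from_0[OF _ h'_deriv h'_cont h'_nonneg h_lim]
      FTC_to_infinity[OF _ u_deriv w_cont w_nonneg filterlim_compose[OF gauss_tendsto_0 T_at_top]] wh];
      assumption)+
  have kernel: "AE r in lborel. indicator {0<..} r * (?h' r * gauss (T r))
      = ?\<nu> * (dens r * (1 / T' r + real m * (r / T r)))"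
    using AE_T'_pos
  proof eventually_elim
    case (elim r)
    show ?case
    proof (cases "0 < r")
      case True
      have dens: "dens r = T r ^ m * gauss (T r) / ?\<nu> * T' r"
        using dens_eq_T'[OF True] T_pos[OF True] by (simp add: radial_density_def[of _ gauss])
      show ?thesis
        unfolding dens using True elim T_pos[OF True] G.moment_pos by (simp add: field_simps)
    qed (simp add: radial_density_def)
  qed
  have "integrable lborel (\<lambda>r. ?\<nu> * (dens r * (1 / T' r + real m * (r / T r))))"
    using parts(1) unfolding set_integrable_def real_scaleR_def
    by (rule integrable_cong_AE_imp[OF _ _ kernel]) simp
  then show "integrable lborel (\<lambda>r. dens r * (1 / T' r + real m * (r / T r)))"
    using G.moment_pos by simp
  have "D_functional (Suc m) f = (\<integral>r. dens r * (T r * Q (F r)) \<partial>lborel)"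
    unfolding D_functional_def T_def by (rule integral_unif01(1)) measurable
  also have "\<dots> = (\<integral>r. dens r * (T r * r) \<partial>lborel)"
    by (rule Bochner_Integration.integral_cong) (auto simp: radial_density_def Q_F)
  finally have D: "D_functional (Suc m) f = (\<integral>r. dens r * (T r * r) \<partial>lborel)" .
  have "?\<nu> * D_functional (Suc m) f = (LBINT s:{0<..}. ?w s * ?h s)"
    unfolding D set_lebesgue_integral_def real_scaleR_def wh_ind by simp
  also have "\<dots> = (\<integral>r. indicator {0<..} r * (?h' r * gauss (T r)) \<partial>lborel)"
    using parts(2) by (simp add: set_lebesgue_integral_def)
  also have "\<dots> = (\<integral>r. ?\<nu> * (dens r * (1 / T' r + real m * (r / T r))) \<partial>lborel)"
    by (rule integral_cong_AE[OF _ _ kernel]) auto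
  finally show "D_functional (Suc m) f = (\<integral>r. dens r * (1 / T' r + real m * (r / T r)) \<partial>lborel)"
    using G.moment_pos by simp
qed

text \<open>
  In \<open>E[T R * score f R]\<close> the factor \<open>f\<close> of the density cancels against the score and leaves
  \<open>- f' * (r ^ m * T)\<close>. Integration by parts moves the derivative to \<open>r ^ m * T\<close>.
\<close>
lemma C_functional_eq:
  assumes ac: "loc_abs_continuous f" and C_int: "integrable unif01 (C_integrand (Suc m) f)"
  shows "integrable lborel (\<lambda>r. dens r * (T' r + real m * (T r / r)))"
    and "C_functional (Suc m) f = (\<integral>r. dens r * (T' r + real m * (T r / r)) \<partial>lborel)"
proof -
  let ?S = "\<lambda>r. C_integrand (Suc m) f (F r)"
  let ?h = "\<lambda>r. r ^ m * T r" and ?h' = "\<lambda>r. r ^ m * (T' r + real m * (T r / r))"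
  \<comment> \<open>This Borel function equals \<open>- deriv f\<close> almost everywhere on \<open>(0, \<infinity>)\<close>; its measurability
     comes from that of the integrand of \<open>C\<close>.\<close>
  define w where "w r = \<mu> * (dens r * ?S r) / ?h r" for r
  have [measurable]: "C_integrand (Suc m) f \<in> borel_measurable borel"
    using borel_measurable_integrable[OF C_int] by simp
  have w_meas [measurable]: "w \<in> borel_measurable borel"
    unfolding w_def[abs_def] by measurable
  have S_int: "integrable lborel (\<lambda>r. dens r * ?S r)"
    using C_int by (subst (asm) integral_unif01(2)) auto
  have C: "C_functional (Suc m) f = (\<integral>r. dens r * ?S r \<partial>lborel)"
    unfolding C_functional_def by (rule integral_unif01(1)) measurable
  have h_pos: "0 < ?h r" if "0 < r" for r
    using T_pos[OF that] that by simp
  have wh_ind: "indicator {0<..} r * (w r * ?h r) = \<mu> * (dens r * ?S r)" for r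
    using h_pos[of r] by (cases "0 < r") (auto simp: w_def radial_density_def)
  have wh: "set_integrable lborel {0<..} (\<lambda>r. w r * ?h r)"
    unfolding set_integrable_def real_scaleR_def wh_ind using S_int by simp
  have w_deriv: "AE r in lborel. 0 < r \<longrightarrow> (f has_real_derivative - w r) (at r)"
  proof -
    have "AE r in lborel. 0 < r \<longrightarrow> (f has_real_derivative deriv f r) (at r)"
      using ac by (simp add: loc_abs_continuous_def)
    then show ?thesis
      using AE_pos
    proof eventually_elim
      case (elim r)
      have "- w r = deriv f r" if "0 < r"
        using elim that T_pos[OF that] moment_pos
        by (simp add: w_def C_integrand_def Q_F score_def radial_density_def T_def)
      then show ?case using elim by simp
    qed
  qed
  \<comment> \<open>\<open>?h\<close> is increasing, so \<open>\<bar>w\<bar> \<le> \<bar>w * ?h\<bar> / ?h r\<close> on \<open>[r, \<infinity>)\<close>.\<close>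
  have w_tail_int: "set_integrable lborel {r..} w" if "0 < r" for r
    unfolding set_integrable_def
  proof (rule Bochner_Integration.integrable_bound)
    show "integrable lborel (\<lambda>s. indicator {0<..} s * (w s * ?h s) / ?h r)"
      using wh by (simp add: set_integrable_def)
    have "\<bar>indicator {r..} s * w s\<bar> \<le> \<bar>indicator {0<..} s * (w s * ?h s) / ?h r\<bar>" for s
    proof (cases "r \<le> s")
      case True
      have "?h r \<le> ?h s"
        using True that T_mono[OF that True] T_pos[OF that]
        by (intro mult_mono power_mono) auto
      then have "\<bar>w s\<bar> * ?h r \<le> \<bar>w s\<bar> * ?h s"
        by (intro mult_left_mono) auto
      then show ?thesis
        using True that h_pos[OF that] T_pos[OF that] T_pos[of s] by (simp add: abs_mult pos_le_divide_eq)
    qed simp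
    then show "AE s in lborel. norm (indicator {r..} s *\<^sub>R w s)
        \<le> norm (indicator {0<..} s * (w s * ?h s) / ?h r)"
      by simp
  qed simp
  have FTC: "(LBINT s:{r..b}. w s) = f r - f b" if "0 < r" "r < b" for r b
  proof -
    have "((\<lambda>s. - w s) has_integral (f b - f r)) {r..b}"
    proof (rule abs_continuous_FTC)
      show "abs_continuous_interval r b f"
        using ac that by (simp add: loc_abs_continuous_def)
      show "AE s in lborel. r \<le> s \<longrightarrow> s \<le> b \<longrightarrow> (f has_real_derivative - w s) (at s)"
        using w_deriv by eventually_elim (use that in auto)
    qed (rule that)
    from has_integral_neg[OF this] have "(w has_integral (f r - f b)) {r..b}" by simp
    moreover have "set_integrable lborel {r..b} w"
      by (rule set_integrable_subset[OF w_tail_int[OF that(1)]]) auto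
    ultimately show ?thesis
      by (simp add: set_borel_integral_eq_integral integral_unique)
  qed
  have tail: "(LBINT s:{r<..}. w s) = f r" if "0 < r" for r
  proof -
    have "((\<lambda>b. LBINT s:{r..b}. w s) \<longlongrightarrow> (LBINT s:{r..}. w s)) at_top"
      by (rule tendsto_set_lebesgue_integral_at_top) (auto intro: w_tail_int that)
    moreover have "eventually (\<lambda>b. (LBINT s:{r..b}. w s) = f r - f b) at_top"
      using eventually_gt_at_top[of r] by eventually_elim (rule FTC[OF that])
    ultimately have "((\<lambda>b. f r - f b) \<longlongrightarrow> (LBINT s:{r..}. w s)) at_top"
      by (rule Lim_transform_eventually)
    then have "((\<lambda>b. f r - (f r - f b)) \<longlongrightarrow> f r - (LBINT s:{r..}. w s)) at_top"
      by (intro tendsto_intros)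
    then have "f r - (LBINT s:{r..}. w s) = 0"
      by (intro limit_at_top_eq_0) simp
    moreover have "(LBINT s:{r..}. w s) = (LBINT s:{r<..}. w s)"
    proof (rule set_integral_cong_set)
      have "AE s in lborel. s \<noteq> r" by (rule AE_lborel_singleton)
      then show "AE s in lborel. (s \<in> {r<..}) = (s \<in> {r..})" by eventually_elim auto
    qed (auto simp: set_borel_measurable_def)
    ultimately show ?thesis by simp
  qed
  have h'_deriv: "(?h has_real_derivative ?h' r) (at r)" if "0 < r" for r
    by (rule DERIV_cong[OF DERIV_mult[OF power_has_derivative[OF that] T_has_derivative[OF that]]])
       (use that in \<open>simp add: field_simps\<close>)
  have h'_cont: "isCont ?h' r" if "0 < r" for r
    using that by (intro continuous_intros T_isCont T'_isCont that) auto
  have h'_nonneg: "0 \<le> ?h' r" if "0 < r" for r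
    using T_pos[OF that] T'_nonneg[OF that] that by simp
  have h_lim: "(?h \<longlongrightarrow> 0) (at_right 0)"
    using tendsto_mult[OF tendsto_power[OF tendsto_ident_at[of 0 "{0<..}"]] T_tendsto_0, of m] by simp
  have meas: "set_borel_measurable borel {0<..} w" "set_borel_measurable borel {0<..} ?h'"
    by (simp_all add: set_borel_measurable_def)
  have parts: "set_integrable lborel {0<..} (\<lambda>r. ?h' r * f r)"
    "(LBINT r:{0<..}. ?h' r * f r) = (LBINT s:{0<..}. w s * ?h s)"
    by (rule Fubini_by_parts[OF meas h'_nonneg FTC_from_0[OF _ h'_deriv h'_cont h'_nonneg h_lim] tail wh];
      assumption)+
  have kernel: "indicator {0<..} r * (?h' r * f r) = \<mu> * (dens r * (T' r + real m * (T r / r)))" for r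
    using moment_pos by (cases "0 < r") (auto simp: radial_density_def)
  show "integrable lborel (\<lambda>r. dens r * (T' r + real m * (T r / r)))"
    using parts(1) moment_pos unfolding set_integrable_def real_scaleR_def kernel by simp
  have "\<mu> * C_functional (Suc m) f = (LBINT s:{0<..}. w s * ?h s)"
    unfolding C set_lebesgue_integral_def real_scaleR_def wh_ind by simp
  also have "\<dots> = (\<integral>r. \<mu> * (dens r * (T' r + real m * (T r / r))) \<partial>lborel)"
    using parts(2) unfolding set_lebesgue_integral_def real_scaleR_def kernel by simp
  finally show "C_functional (Suc m) f = (\<integral>r. dens r * (T' r + real m * (T r / r)) \<partial>lborel)"
    using moment_pos by simp
qed

end

section \<open>The inequality between the two functionals of one radial function\<close>

lemma sum_inverse_ge_2: "2 \<le> x + 1 / x" if "0 < x" for x :: real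
proof -
  have "x + 1 / x - 2 = (x - 1)\<^sup>2 / x" using that by (simp add: field_simps power2_eq_square)
  then show ?thesis using that by (smt (verit) divide_nonneg_pos zero_le_power2)
qed

lemma sum_inverse_eq_2: "x + 1 / x = 2 \<Longrightarrow> 0 < x \<Longrightarrow> x = 1" for x :: real
proof -
  assume "x + 1 / x = 2" "0 < x"
  then have "(x - 1)\<^sup>2 = 0" by (simp add: field_simps power2_eq_square)
  then show ?thesis by simp
qed

context gaussian_transport
begin

lemma T'_if_T_linear:
  assumes T: "\<And>s. 0 < s \<Longrightarrow> T s = a * s" and "0 < r"
  shows "T' r = a"
proof -
  have "(T has_real_derivative a) (at r)"
  proof (rule has_field_derivative_transform_within_open[of "\<lambda>r. a * r" _ _ "{0<..}"])
    show "((*) a has_real_derivative a) (at r)" by (auto intro!: derivative_eq_intros)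
  qed (use T \<open>0 < r\<close> in auto)
  then show ?thesis using T_has_derivative[OF \<open>0 < r\<close>] by (rule DERIV_unique[symmetric])
qed

text \<open>
  For linear \<open>T\<close> the density of the radius is a rescaled Gaussian one, by
  \<open>dens r = G.dens (T r) * T' r\<close>.
\<close>
lemma gaussian_if_T_linear:
  assumes "0 < a" and T: "\<And>r. 0 < r \<Longrightarrow> T r = a * r"
  shows "radial_equiv f (gauss_scaled a)"
proof -
  let ?c = "\<mu> * a ^ Suc m / radial_moment m gauss"
  have "f r = ?c * gauss_scaled a r" if r: "0 < r" for r
  proof -
        have "T' r = a" by (rule T'_if_T_linear[OF T r])
    then have "dens r = G.dens (a * r) * a" using dens_eq_T'[OF r] T[OF r] by simp
    then show ?thesis
      using r \<open>0 < a\<close> moment_pos G.moment_pos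
      by (simp add: radial_density_def gauss_scaled_def field_simps power_mult_distrib)
  qed
  moreover have "0 < ?c" using moment_pos G.moment_pos \<open>0 < a\<close> by simp
  ultimately show ?thesis unfolding radial_equiv_def by blast
qed

text \<open>
  The difference of the two sides of the inequality is the expectation of
  \<open>(t * T' + 1 / (t * T') - 2) + m * (t * T / R + 1 / (t * T / R) - 2)\<close>, whose summands are
  nonnegative. If it vanishes, then so does the first summand almost surely, hence \<open>t * T' = 1\<close>
  almost everywhere; this settles the equality case for all \<open>m\<close> at once.
\<close>
lemma functional_bounds:
  assumes ac: "loc_abs_continuous f" and C_int: "integrable unif01 (C_integrand (Suc m) f)"
    and moment: "finite_radial_moment (m + 2) f" and "0 < t"
  defines "C \<equiv> C_functional (Suc m) f" and "D \<equiv> D_functional (Suc m) f"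
  shows "2 * real (Suc m) \<le> t * C + D / t"
    and "t * C + D / t = 2 * real (Suc m) \<Longrightarrow> radial_equiv f (gauss_scaled (1 / t))"
    and "0 \<le> C"
proof -
  note C_eq = C_functional_eq[OF ac C_int] and D_eq = D_functional_eq[OF moment]
  let ?c = "\<lambda>r. dens r * (T' r + real m * (T r / r))"
    and ?d = "\<lambda>r. dens r * (1 / T' r + real m * (r / T r))"
  let ?K = "\<lambda>r. t * ?c r + ?d r / t - 2 * real (Suc m) * dens r"
  have K_eq: "?K r = dens r * (t * T' r + 1 / (t * T' r) - 2)
      + dens r * real m * (t * T r / r + 1 / (t * T r / r) - 2)" for r
    by (simp add: algebra_simps add_divide_distrib)
  have K_int: "integrable lborel ?K"
    using C_eq(1) D_eq(1) dens_integrable by (intro Bochner_Integration.integrable_add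
      Bochner_Integration.integrable_diff integrable_mult_right integrable_divide)
  have K: "(\<integral>r. ?K r \<partial>lborel) = t * C + D / t - 2 * real (Suc m)"
    using C_eq(1) D_eq(1) dens_integrable
    by (simp add: C_def D_def C_eq(2) D_eq(2) integral_dens)
  have parts: "AE r in lborel. 0 < r \<longrightarrow>
      0 \<le> dens r * (t * T' r + 1 / (t * T' r) - 2) \<and>
      0 \<le> dens r * real m * (t * T r / r + 1 / (t * T r / r) - 2)"
    using AE_T'_pos
  proof eventually_elim
    case (elim r)
    then show ?case
      using sum_inverse_ge_2[of "t * T' r"] sum_inverse_ge_2[of "t * T r / r"] T_pos[of r]
        dens_nonneg[of r] \<open>0 < t\<close> by auto
  qed
  have K_nonneg: "AE r in lborel. 0 \<le> ?K r"
    using parts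
  proof eventually_elim
    case (elim r)
    then show ?case unfolding K_eq by (cases "0 < r") (auto simp: radial_density_def)
  qed
  show "2 * real (Suc m) \<le> t * C + D / t"
    using integral_nonneg_AE[OF K_nonneg] unfolding K by simp
  show "0 \<le> C"
    unfolding C_def C_eq(2)
  proof (intro integral_nonneg_AE AE_I2)
    fix r
    show "0 \<le> ?c r"
    proof (cases "0 < r")
      case True
      then have "0 \<le> T' r + real m * (T r / r)"
        using T_pos[OF True] T'_nonneg[OF True] by simp
      then show ?thesis by (rule mult_nonneg_nonneg[OF dens_nonneg])
    qed (simp add: radial_density_def)
  qed
  assume "t * C + D / t = 2 * real (Suc m)"
  then have "AE r in lborel. ?K r = 0"
    using integral_nonneg_eq_0_iff_AE[OF K_int K_nonneg] unfolding K by simp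
  then have T'_eq: "AE r in lborel. 0 < r \<longrightarrow> T' r = 1 / t"
    using parts AE_T'_pos AE_dens_pos
  proof eventually_elim
    case (elim r)
    show ?case
    proof
      assume r: "0 < r"
      have "dens r * (t * T' r + 1 / (t * T' r) - 2) = 0"
        using elim(1,2) r unfolding K_eq by linarith
      then have "t * T' r + 1 / (t * T' r) = 2" using elim(4) r by simp
      then have "t * T' r = 1" by (rule sum_inverse_eq_2) (use elim(3) r \<open>0 < t\<close> in simp)
      then show "T' r = 1 / t" using \<open>0 < t\<close> by (simp add: field_simps)
    qed
  qed
  have "T r = 1 / t * r" if "0 < r" for r
  proof -
    have "T r = (LBINT s:{0<..<r}. T' s)"
      using FTC_from_0(2)[OF that T_has_derivative T'_isCont T'_nonneg T_tendsto_0] by simp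
    also have "\<dots> = (LBINT s:{0<..<r}. 1 / t)"
      using T'_eq by (intro set_lebesgue_integral_cong_AE) (auto elim: eventually_mono)
    also have "\<dots> = 1 / t * r"
      using that by (simp add: set_lebesgue_integral_def)
    finally show ?thesis .
  qed
  then show "radial_equiv f (gauss_scaled (1 / t))"
    using \<open>0 < t\<close> by (intro gaussian_if_T_linear) auto
qed

text \<open>
  Both \<open>F r\<close> and the Gaussian distribution function at \<open>a * r\<close> have derivatives proportional to
  \<open>r ^ m * gauss (a * r)\<close>. Their limits at \<open>0\<close> and at \<open>\<infinity>\<close> agree, which fixes the additive and the
  multiplicative constant.
\<close>
lemma T_linear_if_gaussian:
  assumes "0 < a" and f: "radial_equiv f (gauss_scaled a)" and "0 < r"
  shows "T r = a * r"
proof -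
  obtain c where "0 < c" and fc: "\<And>r. 0 < r \<Longrightarrow> f r = c * gauss (a * r)"
    using f by (auto simp: radial_equiv_def gauss_scaled_def)
  define K where "K = c * radial_moment m gauss / (\<mu> * a ^ Suc m)"
  define E where "E r = F r - K * G.F (a * r)" for r
  have E_deriv: "(E has_real_derivative 0) (at r)" if "0 < r" for r
  proof -
    have "((\<lambda>r. G.F (a * r)) has_real_derivative G.dens (a * r) * a) (at r)"
      using that \<open>0 < a\<close> by (intro DERIV_chain2[OF G.F_has_derivative]) (auto intro!: derivative_eq_intros)
    from DERIV_diff[OF F_has_derivative[OF that] DERIV_cmult[OF this, of K]]
    have "(E has_real_derivative dens r - K * (G.dens (a * r) * a)) (at r)"
      unfolding E_def[abs_def] .
    moreover have "dens r = K * (G.dens (a * r) * a)"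
      using that \<open>0 < a\<close> moment_pos G.moment_pos fc[OF that]
      by (simp add: K_def radial_density_def field_simps power_mult_distrib)
    ultimately show ?thesis by simp
  qed
  have E_const: "E s = E r" if "0 < s" for s
  proof -
    have "\<exists>k. \<forall>x\<in>{0<..}. E x = k"
      by (rule has_field_derivative_zero_constant)
         (auto intro: has_field_derivative_at_within E_deriv)
    then show ?thesis using that \<open>0 < r\<close> by auto
  qed
  have scale: "filterlim (\<lambda>r. a * r) (at_right 0) (at_right 0)" "filterlim (\<lambda>r. a * r) at_top at_top"
    using \<open>0 < a\<close> by real_asymp+
  have "(E \<longlongrightarrow> 0 - K * 0) (at_right 0)"
    unfolding E_def[abs_def] by (intro tendsto_intros F_tendsto_0 filterlim_compose[OF G.F_tendsto_0 scale(1)])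
  moreover have "eventually (\<lambda>s. E s = E r) (at_right 0)"
    using eventually_at_right_less[of 0] by eventually_elim (rule E_const)
  ultimately have "((\<lambda>_::real. E r) \<longlongrightarrow> 0 - K * 0) (at_right 0)"
    by (rule Lim_transform_eventually)
  then have E_0: "E r = 0" by (simp add: tendsto_const_iff)
  have "(E \<longlongrightarrow> 1 - K * 1) at_top"
    unfolding E_def[abs_def] by (intro tendsto_intros F_tendsto_1 filterlim_compose[OF G.F_tendsto_1 scale(2)])
  moreover have "eventually (\<lambda>s. E s = 0) at_top"
    using eventually_gt_at_top[of 0] by eventually_elim (use E_const E_0 in simp)
  ultimately have "((\<lambda>_::real. 0::real) \<longlongrightarrow> 1 - K * 1) at_top"
    by (rule Lim_transform_eventually)
  then have "K = 1" by (simp add: tendsto_const_iff)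
  then have "F r = G.F (a * r)" using E_0 by (simp add: E_def)
  then show ?thesis using G.Q_F[of "a * r"] \<open>0 < a\<close> \<open>0 < r\<close> by (simp add: T_def)
qed

lemma functionals_gaussian:
  assumes ac: "loc_abs_continuous f" and C_int: "integrable unif01 (C_integrand (Suc m) f)"
    and moment: "finite_radial_moment (m + 2) f"
    and "0 < a" and f: "radial_equiv f (gauss_scaled a)"
  shows "C_functional (Suc m) f = real (Suc m) * a" and "D_functional (Suc m) f = real (Suc m) / a"
proof -
  have T: "T r = a * r" if "0 < r" for r
    using T_linear_if_gaussian[OF \<open>0 < a\<close> f that] .
  have T': "T' r = a" if "0 < r" for r
    using T'_if_T_linear[of a r] T that by blast
  have "dens r * (T' r + real m * (T r / r)) = dens r * (real (Suc m) * a)" for r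
    by (cases "0 < r") (auto simp: T T' algebra_simps, simp add: radial_density_def)
  then show "C_functional (Suc m) f = real (Suc m) * a"
    unfolding C_functional_eq(2)[OF ac C_int] by (simp only: integral_mult_left_zero integral_dens mult_1)
  have "dens r * (1 / T' r + real m * (r / T r)) = dens r * (real (Suc m) / a)" for r
    using \<open>0 < a\<close> by (cases "0 < r") (auto simp: T T' field_simps, simp add: radial_density_def)
  then show "D_functional (Suc m) f = real (Suc m) / a"
    unfolding D_functional_eq(2)[OF moment] by (simp only: integral_mult_left_zero integral_dens mult_1)
qed

end

section \<open>The efficiency bound\<close>

lemma regular_radial_profile:
  assumes "regular_radial_function (Suc m) f"
  shows "gaussian_transport m f"
proof -
  have f: "radial_function (Suc m) f" "loc_abs_continuous f"
    using assms unfolding regular_radial_function_def by blast+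
  have "isCont f x" if "0 < x" for x
  proof (rule abs_continuous_isCont)
    show "abs_continuous_interval (x / 2) (2 * x) f"
      using f(2) that by (simp add: loc_abs_continuous_def)
  qed (use that in auto)
  then have "continuous_on {0<..} f"
    by (intro continuous_at_imp_continuous_on) auto
  then have "radial_profile m f"
    using f(1) unfolding radial_function_def by (intro radial_profile.intro) simp_all
  then show ?thesis
    using radial_profile_gauss by (rule gaussian_transport.intro)
qed

text \<open>
  A linear bound \<open>2 * k \<le> t * C + D / t\<close> for all \<open>t > 0\<close> is equivalent to \<open>k\<^sup>2 \<le> C * D\<close> for positive
  \<open>C\<close> and \<open>D\<close>; the optimal \<open>t\<close> is \<open>sqrt (D / C)\<close>. The bound itself excludes that \<open>C\<close> or \<open>D\<close> vanishes.
\<close>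
lemma CD_inequality:
  assumes reg: "regular_radial_function (Suc m) f" and moment: "finite_radial_moment (m + 2) f"
  defines "C \<equiv> C_functional (Suc m) f" and "D \<equiv> D_functional (Suc m) f"
  shows "0 < C" and "0 < D" and "(real (Suc m))\<^sup>2 \<le> C * D"
    and "C * D = (real (Suc m))\<^sup>2 \<Longrightarrow> \<exists>a>0. radial_equiv f (gauss_scaled a)"
proof -
  interpret gaussian_transport m f by (rule regular_radial_profile[OF reg])
  define k where "k = real (Suc m)"
  have "loc_abs_continuous f" "integrable unif01 (C_integrand (Suc m) f)"
    using reg unfolding regular_radial_function_def by blast+
  note bounds = functional_bounds[OF this moment, folded C_def D_def k_def]
  have "0 < k" by (simp add: k_def)
  have "0 \<le> C" using bounds(3)[of 1] by simp
  have "0 < D"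
  proof (rule ccontr)
    assume "\<not> 0 < D"
    \<comment> \<open>Small enough that \<open>s * C \<le> k\<close>, with \<open>C + 1\<close> in place of \<open>C\<close> as \<open>C\<close> may still be \<open>0\<close> here.\<close>
    define s where "s = k / (C + 1)"
    have "0 < s" using \<open>0 \<le> C\<close> \<open>0 < k\<close> by (simp add: s_def)
    have "2 * k \<le> s * C + D / s" using \<open>0 < s\<close> by (rule bounds(1))
    moreover have "D / s \<le> 0"
      using \<open>\<not> 0 < D\<close> \<open>0 < s\<close> by (intro divide_nonpos_pos) auto
    moreover have "s * C \<le> k"
      using \<open>0 \<le> C\<close> \<open>0 < k\<close> by (simp add: s_def field_simps)
    ultimately show False using \<open>0 < k\<close> by linarith
  qed
  have "C \<noteq> 0"
  proof
    assume "C = 0"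
    \<comment> \<open>With \<open>C = 0\<close> and \<open>t = D / k\<close> the bound reads \<open>2 * k \<le> k\<close>.\<close>
    then show False using bounds(1)[of "D / k"] \<open>0 < D\<close> \<open>0 < k\<close> by simp
  qed
  with \<open>0 \<le> C\<close> have "0 < C" by simp
  show "0 < C" "0 < D" by fact+
  define t where "t = sqrt (D / C)"
  have "0 < t" using \<open>0 < C\<close> \<open>0 < D\<close> by (simp add: t_def)
  have "t\<^sup>2 = D / C" using \<open>0 < C\<close> \<open>0 < D\<close> by (simp add: t_def)
  then have D: "D = t\<^sup>2 * C" using \<open>0 < C\<close> by simp
  have sum: "t * C + D / t = 2 * (t * C)" and prod: "C * D = (t * C)\<^sup>2"
    using \<open>0 < t\<close> by (simp_all add: D power2_eq_square)
  have "k \<le> t * C" using bounds(1)[OF \<open>0 < t\<close>] unfolding sum by simp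
  then show "(real (Suc m))\<^sup>2 \<le> C * D"
    unfolding prod k_def[symmetric] using \<open>0 < k\<close> by (intro power_mono) auto
  assume "C * D = (real (Suc m))\<^sup>2"
  then have "t * C = k"
    unfolding prod k_def[symmetric] using \<open>0 < t\<close> \<open>0 < C\<close> \<open>0 < k\<close> by (auto intro: power2_eq_imp_eq[of "t * C" k])
  then show "\<exists>a>0. radial_equiv f (gauss_scaled a)"
    using bounds(2)[OF \<open>0 < t\<close>] \<open>0 < t\<close> unfolding sum by (intro exI[of _ "1 / t"]) auto
qed

lemma CD_gaussian:
  assumes reg: "regular_radial_function (Suc m) f" and moment: "finite_radial_moment (m + 2) f"
    and "0 < a" and "radial_equiv f (gauss_scaled a)"
  shows "C_functional (Suc m) f = real (Suc m) * a" and "D_functional (Suc m) f = real (Suc m) / a"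
proof -
  interpret gaussian_transport m f by (rule regular_radial_profile[OF reg])
  have "loc_abs_continuous f" "integrable unif01 (C_integrand (Suc m) f)"
    using reg unfolding regular_radial_function_def by blast+
  from functionals_gaussian[OF this moment \<open>0 < a\<close> assms(4)]
  show "C_functional (Suc m) f = real (Suc m) * a" "D_functional (Suc m) f = real (Suc m) / a" .
qed

theorem proposition1:
  fixes p q :: nat and f g :: "real \<Rightarrow> real"
  assumes "1 \<le> p" and "1 \<le> q"
    and "regular_radial_function p f" and "regular_radial_function q g"
    and "finite_radial_moment (p + 1) f" and "finite_radial_moment (q + 1) g"
  shows "ARE_vdW p f q g \<ge> 1 \<and>
    (ARE_vdW p f q g = 1 \<longleftrightarrow>
      (\<exists>a>0. radial_equiv f (gauss_scaled a) \<and> radial_equiv g (gauss_scaled a)))"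
proof -
  obtain m n where pq: "p = Suc m" "q = Suc n"
    using assms(1,2) by (cases p; cases q) auto
  have "finite_radial_moment (m + 2) f" "finite_radial_moment (n + 2) g"
    using assms(5,6) by (simp_all add: pq)
  note f = assms(3)[unfolded pq] this(1) and g = assms(4)[unfolded pq] this(2)
  define C1 D1 C2 D2 where "C1 = C_functional p f" and "D1 = D_functional p f"
    and "C2 = C_functional q g" and "D2 = D_functional q g"
  note defs = this
  note f_bounds = CD_inequality[OF f, folded pq, folded defs]
    and g_bounds = CD_inequality[OF g, folded pq, folded defs]
  note f_gauss = CD_gaussian[OF f, folded pq, folded defs]
    and g_gauss = CD_gaussian[OF g, folded pq, folded defs]
  define x y where "x = D1 * C2" and "y = D2 * C1"
  define N where "N = real p * real q"
  have "0 < N" "0 < x" "0 < y"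
    using assms(1,2) f_bounds(1,2) g_bounds(1,2) by (auto simp: N_def x_def y_def)
  have xy: "x * y = (C1 * D1) * (C2 * D2)" by (simp add: x_def y_def)
  have ARE: "ARE_vdW p f q g = ((x + y) / (2 * N))\<^sup>2"
    by (simp add: ARE_vdW_def x_def y_def N_def defs power_divide power_mult_distrib)
  have N2: "N\<^sup>2 = (real p)\<^sup>2 * (real q)\<^sup>2" by (simp add: N_def power_mult_distrib)
  have xy_ge: "N\<^sup>2 \<le> x * y"
    unfolding xy N2 using f_bounds(3) g_bounds(3) f_bounds(1,2) by (intro mult_mono) auto
  have sq: "(x + y)\<^sup>2 = (x - y)\<^sup>2 + 4 * (x * y)" by (simp add: power2_eq_square algebra_simps)
  have "(2 * N)\<^sup>2 \<le> (x + y)\<^sup>2"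
    unfolding sq using xy_ge by (simp add: power_mult_distrib add_increasing)
  then have ge: "1 \<le> ARE_vdW p f q g"
    unfolding ARE power_divide using \<open>0 < N\<close> by (subst pos_le_divide_eq) auto
  show ?thesis
  proof (intro conjI ge iffI)
    assume "ARE_vdW p f q g = 1"
    then have "(x + y)\<^sup>2 = (2 * N)\<^sup>2"
      unfolding ARE power_divide using \<open>0 < N\<close> by (simp add: field_simps)
    then have "(x - y)\<^sup>2 + 4 * (x * y - N\<^sup>2) = 0"
      unfolding sq by (simp add: power_mult_distrib)
    moreover have "0 \<le> (x - y)\<^sup>2" by simp
    moreover have "0 \<le> 4 * (x * y - N\<^sup>2)" using xy_ge by simp
    ultimately have *: "(x - y)\<^sup>2 = 0 \<and> 4 * (x * y - N\<^sup>2) = 0"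
      by (simp only: add_nonneg_eq_0_iff)
    then have "x = y" by simp
    have prod: "x * y = N\<^sup>2" using conjunct2[OF *] by simp
    have "C1 * D1 = (real p)\<^sup>2"
    proof (rule antisym[OF _ f_bounds(3)], rule ccontr)
      assume "\<not> C1 * D1 \<le> (real p)\<^sup>2"
      then have "N\<^sup>2 < x * y"
        unfolding xy N2 using g_bounds(3) assms(2) f_bounds(1,2) by (intro mult_less_le_imp_less) auto
      with prod show False by simp
    qed
    moreover have "C2 * D2 = (real q)\<^sup>2"
    proof (rule antisym[OF _ g_bounds(3)], rule ccontr)
      assume "\<not> C2 * D2 \<le> (real q)\<^sup>2"
      then have "N\<^sup>2 < x * y"
        unfolding xy N2 using f_bounds(3) assms(1) f_bounds(1,2) by (intro mult_le_less_imp_less) auto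
      with prod show False by simp
    qed
    ultimately obtain a b where a: "0 < a" "radial_equiv f (gauss_scaled a)"
      and b: "0 < b" "radial_equiv g (gauss_scaled b)"
      using f_bounds(4) g_bounds(4) by blast
    have "N * (b / a) = N * (a / b)"
      using \<open>x = y\<close> f_gauss[OF a] g_gauss[OF b] by (simp add: x_def y_def N_def mult_ac)
    then have "b / a = a / b" using mult_cancel_left[of N] \<open>0 < N\<close> by blast
    then have "a\<^sup>2 = b\<^sup>2" using a(1) b(1) by (simp add: field_simps power2_eq_square)
    then have "a = b" using a(1) b(1) by (simp add: power2_eq_iff)
    then show "\<exists>a>0. radial_equiv f (gauss_scaled a) \<and> radial_equiv g (gauss_scaled a)"
      using a b by blast
  next
    assume "\<exists>a>0. radial_equiv f (gauss_scaled a) \<and> radial_equiv g (gauss_scaled a)"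
    then obtain a where a: "0 < a" "radial_equiv f (gauss_scaled a)" "radial_equiv g (gauss_scaled a)"
      by blast
    have "x = N" "y = N"
      using f_gauss[OF a(1,2)] g_gauss[OF a(1,3)] a(1) by (simp_all add: x_def y_def N_def)
    then show "ARE_vdW p f q g = 1" unfolding ARE using \<open>0 < N\<close> by simp
  qed
qed

end
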